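(* (Master formula.) Let $(\boldsymbol{\alpha},\mathbf{T},\mathbf{U},\mathbf{Q}_1,\mathbf{Q}_2)$ be the parameters of a common-shock phase-type model with common-shock time $\tau_{1,2}$ and residual lifetimes $\tilde\tau_1,\tilde\tau_2$. Let $\mathbf{n}=(n_{1,2},n_1,n_2)$ with entries in $\mathbb{N}_0=\{0,1,2,\dots\}$, $\boldsymbol{\theta}=(\theta_{1,2},\theta_1,\theta_2)$ with real entries, and $\mathbf{y}=(y_{1,2},y_1,y_2)$ with nonnegative entries. Assume that the integrals $\int_{y_{1,2}}^\infty e^{\mathbf{T}^{(n_{1,2},\theta_{1,2})}x}\,dx$ and $\int_{y_i}^\infty e^{\mathbf{Q}_i^{(n_i,\theta_i)}x}\,dx$, $i=1,2$, converge and that the matrices $\mathbf{T}^{(n_{1,2},\theta_{1,2})}$, $\mathbf{Q}_1^{(n_1,\theta_1)}$, $\mathbf{Q}_2^{(n_2,\theta_2)}$ are invertible. Then \begin{align*} \mathcal{M}_{\mathbf{n},\boldsymbol{\theta},\mathbf{y}}:=\;&\mathbb{E}\Bigl[\bigl(\tau_{1,2}^{n_{1,2}}e^{-\theta_{1,2}\tau_{1,2}}\bigr)\bigl(\tilde\tau_1^{n_1}e^{-\theta_1\tilde\tau_1}\bigr)\bigl(\tilde\tau_2^{n_2}e^{-\theta_2\tilde\tau_2}\bigr)\mathds{1}_{\{\tau_{1,2}>y_{1,2},\,\tilde\tau_1>y_1,\,\tilde\tau_2>y_2\}}\Bigr]\\ =\;&(n_{1,2}!\,n_1!\,n_2!)\,\boldsymbol{\alpha}^{(n_{1,2})}e^{\mathbf{T}^{(n_{1,2},\theta_{1,2})}y_{1,2}}\bigl(-\mathbf{T}^{(n_{1,2},\theta_{1,2})}\bigr)^{-1}\mathbf{I}^{(\downarrow,n_{1,2})}\mathbf{P}\\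 &\times\Bigl[\Bigl(\mathbf{I}^{(\leftarrow,n_1)}e^{\mathbf{Q}_1^{(n_1,\theta_1)}y_1}\bigl(-\mathbf{Q}_1^{(n_1,\theta_1)}\bigr)^{-1}\mathbf{q}_1^{(n_1)}\Bigr)\otimes\Bigl(\mathbf{I}^{(\leftarrow,n_2)}e^{\mathbf{Q}_2^{(n_2,\theta_2)}y_2}\bigl(-\mathbf{Q}_2^{(n_2,\theta_2)}\bigr)^{-1}\mathbf{q}_2^{(n_2)}\Bigr)\Bigr], \end{align*} where $\times$ denotes the ordinary matrix product, $\mathbf{P}=\sum_{k\in\mathcal{S}}\mathbf{U}\mathbf{e}_k(\mathbf{e}_k^\top\otimes\mathbf{e}_k^\top)$, $\mathbf{q}_i=-\mathbf{Q}_i\mathbf{1}$, and the augmented objects $\boldsymbol{\alpha}^{(N)}$, $\mathbf{M}^{(N,\theta)}$ (for $\mathbf{M}=\mathbf{T},\mathbf{Q}_1,\mathbf{Q}_2$), $\mathbf{q}_i^{(N)}$, $\mathbf{I}^{(\downarrow,N)}$, $\mathbf{I}^{(\leftarrow,N)}$ are the block vectors and matrices, with $N+1$ blocks, defined in the context.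
   Context: Model. $\mathcal{E}$ (pre-shock states) and $\mathcal{S}$ (post-shock states) are disjoint finite nonempty sets; $\boldsymbol{\alpha}$ is a row probability vector on $\mathcal{E}$; $\mathbf{T}$ is a subintensity matrix on $\mathcal{E}$ and $\mathbf{Q}_1,\mathbf{Q}_2$ are subintensity matrices on $\mathcal{S}$ (nonpositive diagonal entries, nonnegative off-diagonal entries, nonpositive row sums), all of whose states are transient (equivalently, the matrices are nonsingular); $\mathbf{U}$ is an entrywise nonnegative $|\mathcal{E}|\times|\mathcal{S}|$ matrix with $\mathbf{T}\mathbf{1}+\mathbf{U}\mathbf{1}=\mathbf{0}$. A Markov jump process starts in $\mathcal{E}$ according to $\boldsymbol{\alpha}$, moves in $\mathcal{E}$ with rates $\mathbf{T}$ and jumps to $\mathcal{S}$ with rates $\mathbf{U}$; $\tau_{1,2}$ is its exit time from $\mathcal{E}$ and $K$ the state of $\mathcal{S}$ entered then. Given $K$, two processes start from $K$ and evolve on $\mathcal{S}$ independently of each other and of $\tau_{1,2}$, with subintensity matrices $\mathbf{Q}_1,\mathbf{Q}_2$, until absorption outside $\mathcal{E}\cup\mathcal{S}$; $\tilde\tau_1,\tilde\tau_2$ are their absorption times, measured from the shock. The joint density of $(\tau_{1,2},\tilde\tau_1,\tilde\tau_2)$ on $[0,\infty)^3$ is $g(t,y_1,y_2)=\boldsymbol{\alpha}e^{\mathbf{T}t}\mathbf{P}\bigl((e^{\mathbf{Q}_1y_1}\mathbf{q}_1)\otimes(e^{\mathbf{Q}_2y_2}\mathbf{q}_2)\bigr)$.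 Augmented objects. For $N\in\mathbb{N}_0$, $\theta\in\mathbb{R}$ and a $p\times p$ matrix $\mathbf{M}$: $\boldsymbol{\alpha}^{(N)}=(\boldsymbol{\alpha},\mathbf{0},\dots,\mathbf{0})$ is a row vector with $N+1$ blocks of length $|\mathcal{E}|$; $\mathbf{M}^{(N,\theta)}$ is the $(N+1)p\times(N+1)p$ block upper bidiagonal matrix with $N+1$ diagonal blocks $\mathbf{M}-\theta\mathbf{I}$, all blocks on the first superdiagonal equal to $\mathbf{I}$ (the $p\times p$ identity), and all other blocks zero; $\mathbf{q}_i^{(N)}$ is the column vector with $N+1$ blocks of length $|\mathcal{S}|$, the last block being $\mathbf{q}_i$ and the others zero; $\mathbf{I}^{(\downarrow,N)}$ is the $(N+1)p\times p$ matrix whose last $p\times p$ block is $\mathbf{I}$ and whose other blocks are zero (here $p=|\mathcal{E}|$); $\mathbf{I}^{(\leftarrow,N)}=(\mathbf{I},\mathbf{0},\dots,\mathbf{0})$ is the $p\times(N+1)p$ matrix whose first $p\times p$ block is $\mathbf{I}$ and whose other blocks are zero (here $p=|\mathcal{S}|$). Notation: $\mathbf{1}$ is a column vector of ones, $\mathbf{e}_k$ the $k$-th standard basis column vector of $\mathbb{R}^{\mathcal{S}}$, $\otimes$ the Kronecker product, $\mathds{1}_A$ the indicator of the event $A$. *)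

theory Defs
  imports "HOL-Probability.Probability" "Jordan_Normal_Form.Gauss_Jordan_Elimination"
begin

text \<open>
  The pre-shock states are \<open>0, ..., m - 1\<close>, the post-shock states \<open>0, ..., p - 1\<close>. Row and column
  vectors are matrices with one row or one column.
\<close>

section \<open>Matrices\<close>

definition mexp :: "real mat \<Rightarrow> real mat" where
  "mexp A = mat (dim_row A) (dim_col A) (\<lambda>(i, j). \<Sum>k. (A ^\<^sub>m k) $$ (i, j) / fact k)"

definition kron :: "real mat \<Rightarrow> real mat \<Rightarrow> real mat" where
  "kron A B = mat (dim_row A * dim_row B) (dim_col A * dim_col B)
     (\<lambda>(i, j). A $$ (i div dim_row B, j div dim_col B) * B $$ (i mod dim_row B, j mod dim_col B))"

text \<open>Only used for invertible arguments; \<open>mat_inverse\<close> returns \<open>None\<close> on all others.\<close>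

definition minv :: "real mat \<Rightarrow> real mat" where
  "minv A = the (mat_inverse A)"

definition ones :: "nat \<Rightarrow> real mat" where
  "ones p = mat p 1 (\<lambda>_. 1)"

definition unit_col :: "nat \<Rightarrow> nat \<Rightarrow> real mat" where
  "unit_col p k = mat p 1 (\<lambda>(i, _). if i = k then 1 else 0)"

text \<open>\<open>\<Sum>k. U e\<^sub>k (e\<^sub>k\<^sup>T \<otimes> e\<^sub>k\<^sup>T)\<close>; the sum is taken entrywise because matrices of all sizes share one
  type, which therefore has no zero for \<open>sum\<close>.\<close>

definition shock_matrix :: "real mat \<Rightarrow> real mat" where
  "shock_matrix U = (let p = dim_col U in
     mat (dim_row U) (p * p) (\<lambda>(i, j). \<Sum>k<p.
       ((U * unit_col p k) * kron (transpose_mat (unit_col p k)) (transpose_mat (unit_col p k))) $$ (i, j)))"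

definition exit_rates :: "real mat \<Rightarrow> real mat" where
  "exit_rates Q = - (Q * ones (dim_col Q))"

text \<open>Augmented objects: index \<open>i\<close> lies in block \<open>i div p\<close>, at position \<open>i mod p\<close>.\<close>

definition aug_row :: "nat \<Rightarrow> real mat \<Rightarrow> real mat" where
  "aug_row N \<alpha> = mat 1 ((N + 1) * dim_col \<alpha>) (\<lambda>(_, j). if j < dim_col \<alpha> then \<alpha> $$ (0, j) else 0)"

definition aug_mat :: "nat \<Rightarrow> real \<Rightarrow> real mat \<Rightarrow> real mat" where
  "aug_mat N \<theta> A = (let p = dim_row A in
     mat ((N + 1) * p) ((N + 1) * p) (\<lambda>(i, j).
       if j div p = i div p then (A - \<theta> \<cdot>\<^sub>m 1\<^sub>m p) $$ (i mod p, j mod p)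
       else if j div p = i div p + 1 then 1\<^sub>m p $$ (i mod p, j mod p)
       else 0))"

definition aug_col :: "nat \<Rightarrow> real mat \<Rightarrow> real mat" where
  "aug_col N q = (let p = dim_row q in
     mat ((N + 1) * p) 1 (\<lambda>(i, _). if i div p = N then q $$ (i mod p, 0) else 0))"

definition id_down :: "nat \<Rightarrow> nat \<Rightarrow> real mat" where
  "id_down N p = mat ((N + 1) * p) p (\<lambda>(i, j). if i div p = N then 1\<^sub>m p $$ (i mod p, j) else 0)"

definition id_left :: "nat \<Rightarrow> nat \<Rightarrow> real mat" where
  "id_left N p = mat p ((N + 1) * p) (\<lambda>(i, j). if j div p = 0 then 1\<^sub>m p $$ (i, j mod p) else 0)"

text \<open>Convergence of \<open>\<integral>\<^sub>y\<^sup>\<infinity> e\<^bsup>Ax\<^esup> dx\<close>. By Hake's theorem a continuous function has a gauge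
  integral over \<open>{y..}\<close> exactly if its improper Riemann integral converges.\<close>

definition exp_integral_converges :: "real mat \<Rightarrow> real \<Rightarrow> bool" where
  "exp_integral_converges A y \<longleftrightarrow>
     (\<forall>i<dim_row A. \<forall>j<dim_col A. (\<lambda>x. mexp (x \<cdot>\<^sub>m A) $$ (i, j)) integrable_on {y..})"

definition subintensity :: "nat \<Rightarrow> real mat \<Rightarrow> bool" where
  "subintensity n A \<longleftrightarrow> A \<in> carrier_mat n n \<and>
     (\<forall>i<n. A $$ (i, i) \<le> 0) \<and>
     (\<forall>i<n. \<forall>j<n. i \<noteq> j \<longrightarrow> 0 \<le> A $$ (i, j)) \<and>
     (\<forall>i<n. (\<Sum>j<n. A $$ (i, j)) \<le> 0)"

section \<open>Markov jump processes\<close>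

text \<open>Time runs through the nonnegative reals; the values of a process at negative times are never
  used.\<close>

definition jump_process :: "'w measure \<Rightarrow> nat \<Rightarrow> (real \<Rightarrow> 'w \<Rightarrow> nat) \<Rightarrow> bool" where
  "jump_process M n X \<longleftrightarrow>
     (\<forall>t\<ge>0. X t \<in> M \<rightarrow>\<^sub>M count_space {..<n}) \<and>
     (\<forall>\<omega>\<in>space M. \<forall>t\<ge>0. \<exists>\<epsilon>>0. \<forall>s\<in>{t..<t + \<epsilon>}. X s \<omega> = X t \<omega>) \<and>
     (\<forall>\<omega>\<in>space M. \<forall>t>0. \<exists>\<epsilon>>0. \<exists>j. \<forall>s\<in>{t - \<epsilon><..<t}. 0 \<le> s \<longrightarrow> X s \<omega> = j)"

definition sigma_events :: "'w measure \<Rightarrow> real set \<Rightarrow> (real \<Rightarrow> 'w \<Rightarrow> nat) \<Rightarrow> 'w set set" where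
  "sigma_events M I X = sigma_sets (space M) {X t -` B \<inter> space M | t B. t \<in> I}"

text \<open>The last conjunct is the Markov property
  \<open>P(X\<^bsub>s+h\<^esub> = j | A, X\<^sub>s = i) = (e\<^bsup>\<Lambda>h\<^esup>)\<^sub>i\<^sub>j\<close> for \<open>A\<close> in the history up to time \<open>s\<close>, multiplied out so
  that null events need no exception.\<close>

definition markov_jump_process ::
  "'w measure \<Rightarrow> nat \<Rightarrow> (nat \<Rightarrow> real) \<Rightarrow> real mat \<Rightarrow> (real \<Rightarrow> 'w \<Rightarrow> nat) \<Rightarrow> bool" where
  "markov_jump_process M n \<pi> \<Lambda> X \<longleftrightarrow> jump_process M n X \<and>
     (\<forall>i<n. measure M {\<omega> \<in> space M. X 0 \<omega> = i} = \<pi> i) \<and>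
     (\<forall>s\<ge>0. \<forall>h\<ge>0. \<forall>i<n. \<forall>j<n. \<forall>A\<in>sigma_events M {0..s} X.
        measure M {\<omega> \<in> A. X s \<omega> = i \<and> X (s + h) \<omega> = j} =
        measure M {\<omega> \<in> A. X s \<omega> = i} * mexp (h \<cdot>\<^sub>m \<Lambda>) $$ (i, j))"

text \<open>In the models below the exit is almost surely finite; paths that never leave \<open>S\<close> are given
  the value \<open>0\<close>.\<close>

definition exit_time :: "nat set \<Rightarrow> (real \<Rightarrow> 'w \<Rightarrow> nat) \<Rightarrow> 'w \<Rightarrow> real" where
  "exit_time S X \<omega> = (if \<exists>t\<ge>0. X t \<omega> \<notin> S then Inf {t. 0 \<le> t \<and> X t \<omega> \<notin> S} else 0)"

section \<open>The common-shock phase-type model\<close>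

text \<open>Since \<open>T\<close>, \<open>Q1\<close> and \<open>Q2\<close> are subintensity matrices, invertibility says that all states are
  transient.\<close>

definition common_shock_parameters ::
  "nat \<Rightarrow> nat \<Rightarrow> real mat \<Rightarrow> real mat \<Rightarrow> real mat \<Rightarrow> real mat \<Rightarrow> real mat \<Rightarrow> bool" where
  "common_shock_parameters m p \<alpha> T U Q1 Q2 \<longleftrightarrow>
     0 < m \<and> 0 < p \<and>
     \<alpha> \<in> carrier_mat 1 m \<and> (\<forall>i<m. 0 \<le> \<alpha> $$ (0, i)) \<and> (\<Sum>i<m. \<alpha> $$ (0, i)) = 1 \<and>
     subintensity m T \<and> invertible_mat T \<and>
     subintensity p Q1 \<and> invertible_mat Q1 \<and>
     subintensity p Q2 \<and> invertible_mat Q2 \<and>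
     U \<in> carrier_mat m p \<and> (\<forall>i<m. \<forall>k<p. 0 \<le> U $$ (i, k)) \<and>
     T * ones m + U * ones p = 0\<^sub>m m 1"

text \<open>The process \<open>Z\<close> lives on \<open>{..<m + p}\<close>, where \<open>m + k\<close> encodes the post-shock state \<open>k\<close>, and is
  stopped when it enters a post-shock state. The processes \<open>Y1\<close>, \<open>Y2\<close> live on \<open>{..p}\<close>, where \<open>p\<close>
  encodes the absorbing state; their time is measured from the shock.\<close>

definition shock_intensity :: "nat \<Rightarrow> nat \<Rightarrow> real mat \<Rightarrow> real mat \<Rightarrow> real mat" where
  "shock_intensity m p T U = four_block_mat T U (0\<^sub>m p m) (0\<^sub>m p p)"

definition residual_intensity :: "nat \<Rightarrow> real mat \<Rightarrow> real mat" where
  "residual_intensity p Q = four_block_mat Q (exit_rates Q) (0\<^sub>m 1 p) (0\<^sub>m 1 1)"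

definition shock_time :: "nat \<Rightarrow> (real \<Rightarrow> 'w \<Rightarrow> nat) \<Rightarrow> 'w \<Rightarrow> real" where
  "shock_time m Z = exit_time {..<m} Z"

definition residual_lifetime :: "nat \<Rightarrow> (real \<Rightarrow> 'w \<Rightarrow> nat) \<Rightarrow> 'w \<Rightarrow> real" where
  "residual_lifetime p Y = exit_time {..<p} Y"

definition given_shock_state ::
  "'w measure \<Rightarrow> nat \<Rightarrow> (real \<Rightarrow> 'w \<Rightarrow> nat) \<Rightarrow> nat \<Rightarrow> 'w measure" where
  "given_shock_state M m Z k = uniform_measure M {\<omega> \<in> space M. Z (shock_time m Z \<omega>) \<omega> = m + k}"

definition common_shock_model ::
  "'w measure \<Rightarrow> nat \<Rightarrow> nat \<Rightarrow> real mat \<Rightarrow> real mat \<Rightarrow> real mat \<Rightarrow> real mat \<Rightarrow> real mat \<Rightarrow>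
   (real \<Rightarrow> 'w \<Rightarrow> nat) \<Rightarrow> (real \<Rightarrow> 'w \<Rightarrow> nat) \<Rightarrow> (real \<Rightarrow> 'w \<Rightarrow> nat) \<Rightarrow> bool" where
  "common_shock_model M m p \<alpha> T U Q1 Q2 Z Y1 Y2 \<longleftrightarrow>
     prob_space M \<and>
     common_shock_parameters m p \<alpha> T U Q1 Q2 \<and>
     markov_jump_process M (m + p) (\<lambda>i. if i < m then \<alpha> $$ (0, i) else 0)
       (shock_intensity m p T U) Z \<and>
     jump_process M (p + 1) Y1 \<and> jump_process M (p + 1) Y2 \<and>
     (\<forall>k<p. 0 < measure M {\<omega> \<in> space M. Z (shock_time m Z \<omega>) \<omega> = m + k} \<longrightarrow>
       (let M' = given_shock_state M m Z k; \<delta> = (\<lambda>i. if i = k then 1 else 0) in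
         markov_jump_process M' (p + 1) \<delta> (residual_intensity p Q1) Y1 \<and>
         markov_jump_process M' (p + 1) \<delta> (residual_intensity p Q2) Y2 \<and>
         prob_space.indep_sets M'
           (\<lambda>i. [{shock_time m Z -` B \<inter> space M | B. B \<in> sets borel},
                 sigma_events M {0..} Y1,
                 sigma_events M {0..} Y2] ! i) {..<3}))"

end

theory Submission
  imports Defs
begin

text \<open>
  Write \<open>\<tau>\<close> for the shock time, \<open>K\<close> for the post-shock state entered at \<open>\<tau>\<close>, and \<open>R1\<close>, \<open>R2\<close> for the
  residual lifetimes. Given \<open>K = k\<close> the three times are independent, so the expectation is the sum
  over \<open>k\<close> of products of three factors: the weighted tail moment of \<open>\<tau>\<close> on \<open>{K = k}\<close> and the
  conditional tail moments of \<open>R1\<close> and \<open>R2\<close>. The shock matrix and the Kronecker product encode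
  exactly this sum (lemmas \<open>shock_matrix_kron_index\<close> and \<open>master_product_entry\<close>).

  All three factors are instances of one computation. Let \<open>X\<close> be a Markov jump process with
  generator \<open>[[T, U], [0, 0]]\<close> that starts from \<open>\<pi>\<close>. The states of \<open>T\<close> are left at a time \<open>\<tau>\<close>,
  and since the other states are absorbing, \<open>{\<tau> \<le> t, X\<^sub>\<tau> = m + k}\<close> is almost surely the event
  \<open>{X\<^sub>t = m + k}\<close>, whose probability is an entry of \<open>\<pi> e\<^bsup>\<Lambda>t\<^esup>\<close>. Differentiating in \<open>t\<close> shows that on
  \<open>(0, \<infinity>)\<close> the pair \<open>(\<tau>, X\<^sub>\<tau>)\<close> has density \<open>\<pi> e\<^bsup>Tt\<^esup> U e\<^sub>k\<close> (lemma \<open>nn_integral_exit\<close>). For the residual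
  lifetimes \<open>U\<close> has the single column of exit rates.

  The weight \<open>t\<^bsup>N\<^esup> e\<^bsup>-\<theta>t\<^esup>\<close> is absorbed into the matrix exponential: the top right block of
  \<open>exp (t T\<^bsup>(N,\<theta>)\<^esup>)\<close> is \<open>t\<^bsup>N\<^esup>/N! e\<^bsup>-\<theta>t\<^esup> e\<^bsup>Tt\<^esup>\<close> (lemma \<open>mexp_aug_mat_first_row\<close>). With
  \<open>A = T\<^bsup>(N,\<theta>)\<^esup>\<close> the moment is therefore a combination of entries of \<open>\<integral>\<^sub>y\<^sup>\<infinity> e\<^bsup>At\<^esup> dt\<close>, and \<open>e\<^bsup>At\<^esup> (-A)\<^sup>-\<^sup>1\<close> is an
  antiderivative of \<open>-e\<^bsup>At\<^esup>\<close> that vanishes at infinity because the integral converges (lemma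
  \<open>mexp_antiderivative_tendsto_0\<close>).

  All integrands are nonnegative, so the whole argument is carried out with nonnegative Lebesgue
  integrals, where integrability is part of the result.
\<close>

section \<open>The matrix exponential and linear differential equations\<close>

lemma index_mult_mat_sum:
  assumes "A \<in> carrier_mat a b" "B \<in> carrier_mat b c" "i < a" "j < c"
  shows "(A * B) $$ (i, j) = (\<Sum>l<b. A $$ (i, l) * B $$ (l, j))"
  using assms by (auto simp: scalar_prod_def lessThan_atLeast0)

lemma zero_less_one_nat: "(0 :: nat) < 1"
  by simp

lemma pow_mat_Suc_left:
  fixes A :: "'a :: semiring_1 mat"
  assumes "A \<in> carrier_mat n n"
  shows "A ^\<^sub>m Suc k = A * A ^\<^sub>m k"
proof (induction k)
  case 0
  then show ?case using assms by simp
next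
  case (Suc k)
  have "A ^\<^sub>m Suc (Suc k) = (A * A ^\<^sub>m k) * A"
    using Suc by simp
  also have "\<dots> = A * A ^\<^sub>m Suc k"
    using assms by (simp add: assoc_mult_mat[of _ n n _ n _ n])
  finally show ?case .
qed

lemma smult_pow_mat_index:
  fixes A :: "real mat"
  assumes "A \<in> carrier_mat n n" "i < n" "j < n"
  shows "((t \<cdot>\<^sub>m A) ^\<^sub>m k) $$ (i, j) = t ^ k * (A ^\<^sub>m k) $$ (i, j)"
  using assms(2,3)
proof (induction k arbitrary: i j)
  case 0
  then show ?case using assms by simp
next
  case (Suc k)
  have "((t \<cdot>\<^sub>m A) ^\<^sub>m Suc k) $$ (i, j) = (\<Sum>l<n. ((t \<cdot>\<^sub>m A) ^\<^sub>m k) $$ (i, l) * (t \<cdot>\<^sub>m A) $$ (l, j))"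
    using assms Suc.prems by (simp add: index_mult_mat_sum[of _ n n _ n] del: index_mult_mat)
  also have "\<dots> = t ^ Suc k * (\<Sum>l<n. (A ^\<^sub>m k) $$ (i, l) * A $$ (l, j))"
    using assms Suc by (simp add: sum_distrib_left mult_ac)
  also have "\<dots> = t ^ Suc k * (A ^\<^sub>m Suc k) $$ (i, j)"
    using assms Suc.prems by (simp add: index_mult_mat_sum[of _ n n _ n] del: index_mult_mat)
  finally show ?case .
qed

lemma mexp_carrier [simp]: "A \<in> carrier_mat n n \<Longrightarrow> mexp A \<in> carrier_mat n n"
  by (auto simp: mexp_def)

text \<open>
  The sum of the absolute values of all entries dominates every column sum, which makes it a
  growth rate for the powers.
\<close>

lemma pow_mat_entry_bound:
  fixes A :: "real mat"
  assumes A: "A \<in> carrier_mat n n"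
  obtains C where "\<And>k i j. i < n \<Longrightarrow> j < n \<Longrightarrow> \<bar>(A ^\<^sub>m k) $$ (i, j)\<bar> \<le> C ^ k"
proof
  define C where "C = (\<Sum>l<n. \<Sum>j<n. \<bar>A $$ (l, j)\<bar>)"
  have col: "(\<Sum>l<n. \<bar>A $$ (l, j)\<bar>) \<le> C" if "j < n" for j
    unfolding C_def using that
    by (intro sum_mono member_le_sum) auto
  have C0: "0 \<le> C" unfolding C_def by (intro sum_nonneg) auto
  show "\<bar>(A ^\<^sub>m k) $$ (i, j)\<bar> \<le> C ^ k" if "i < n" "j < n" for k i j
    using that
  proof (induction k arbitrary: j)
    case 0
    then show ?case using A by simp
  next
    case (Suc k)
    have "\<bar>(A ^\<^sub>m Suc k) $$ (i, j)\<bar> = \<bar>\<Sum>l<n. (A ^\<^sub>m k) $$ (i, l) * A $$ (l, j)\<bar>"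
      using A Suc.prems by (simp add: index_mult_mat_sum[of _ n n _ n] del: index_mult_mat)
    also have "\<dots> \<le> (\<Sum>l<n. C ^ k * \<bar>A $$ (l, j)\<bar>)"
      using Suc by (intro order_trans[OF sum_abs] sum_mono) (auto simp: abs_mult intro!: mult_right_mono)
    also have "\<dots> = C ^ k * (\<Sum>l<n. \<bar>A $$ (l, j)\<bar>)"
      by (simp add: sum_distrib_left)
    also have "\<dots> \<le> C ^ Suc k"
      using mult_left_mono[OF col[of j], of "C ^ k"] Suc.prems C0 by (simp add: mult.commute)
    finally show ?case .
  qed
qed

lemma summable_mexp_series:
  fixes A :: "real mat"
  assumes "A \<in> carrier_mat n n" "i < n" "j < n"
  shows "summable (\<lambda>k. (A ^\<^sub>m k) $$ (i, j) / fact k * t ^ k)"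
proof -
  obtain C where C: "\<And>k. \<bar>(A ^\<^sub>m k) $$ (i, j)\<bar> \<le> C ^ k"
    using pow_mat_entry_bound[OF assms(1)] assms(2,3) by metis
  show ?thesis
  proof (rule summable_comparison_test')
    show "summable (\<lambda>k. (C * \<bar>t\<bar>) ^ k /\<^sub>R fact k)"
      by (rule summable_exp_generic)
    show "norm ((A ^\<^sub>m k) $$ (i, j) / fact k * t ^ k) \<le> (C * \<bar>t\<bar>) ^ k /\<^sub>R fact k" for k
      using mult_right_mono[OF C[of k], of "\<bar>t\<bar> ^ k / fact k"]
      by (simp add: abs_mult power_abs power_mult_distrib divide_inverse mult_ac)
  qed
qed

lemma mexp_smult_index:
  fixes A :: "real mat"
  assumes "A \<in> carrier_mat n n" "i < n" "j < n"
  shows "mexp (t \<cdot>\<^sub>m A) $$ (i, j) = (\<Sum>k. (A ^\<^sub>m k) $$ (i, j) / fact k * t ^ k)"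
  using assms by (simp add: mexp_def smult_pow_mat_index mult_ac)

lemma mexp_0_index:
  fixes A :: "real mat"
  assumes "A \<in> carrier_mat n n" "i < n" "j < n"
  shows "mexp (0 \<cdot>\<^sub>m A) $$ (i, j) = (if i = j then 1 else 0)"
  using assms powser_zero[of "\<lambda>k. (A ^\<^sub>m k) $$ (i, j) / fact k"]
  by (simp add: mexp_smult_index[of A n])

lemma mexp_has_derivative_series:
  fixes A :: "real mat"
  assumes "A \<in> carrier_mat n n" "i < n" "j < n"
  shows "((\<lambda>t. mexp (t \<cdot>\<^sub>m A) $$ (i, j)) has_real_derivative
           (\<Sum>k. (A ^\<^sub>m Suc k) $$ (i, j) / fact k * t ^ k)) (at t)"
proof -
  have d: "diffs (\<lambda>k. (A ^\<^sub>m k) $$ (i, j) / fact k) = (\<lambda>k. (A ^\<^sub>m Suc k) $$ (i, j) / fact k)"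
    by (simp add: diffs_def fun_eq_iff del: pow_mat.simps of_nat_Suc)
  show ?thesis
    using termdiffs_strong_converges_everywhere[OF summable_mexp_series[OF assms]]
    unfolding d mexp_smult_index[OF assms] .
qed

lemma mexp_has_derivative_right:
  fixes A :: "real mat"
  assumes A: "A \<in> carrier_mat n n" and ij: "i < n" "j < n"
  shows "((\<lambda>t. mexp (t \<cdot>\<^sub>m A) $$ (i, j)) has_real_derivative
           (\<Sum>l<n. mexp (t \<cdot>\<^sub>m A) $$ (i, l) * A $$ (l, j))) (at t)"
proof -
  have "(\<Sum>k. (A ^\<^sub>m Suc k) $$ (i, j) / fact k * t ^ k) =
        (\<Sum>k. \<Sum>l<n. ((A ^\<^sub>m k) $$ (i, l) / fact k * t ^ k) * A $$ (l, j))"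
    using A ij by (simp add: index_mult_mat_sum[of _ n n _ n] sum_distrib_left sum_distrib_right
      sum_divide_distrib mult_ac del: index_mult_mat)
  also have "\<dots> = (\<Sum>l<n. \<Sum>k. ((A ^\<^sub>m k) $$ (i, l) / fact k * t ^ k) * A $$ (l, j))"
    using A ij by (intro suminf_sum summable_mult2 summable_mexp_series[of A n]) auto
  also have "\<dots> = (\<Sum>l<n. mexp (t \<cdot>\<^sub>m A) $$ (i, l) * A $$ (l, j))"
    by (intro sum.cong refl) (simp only: mexp_smult_index[OF A] suminf_mult2[symmetric]
      summable_mexp_series[OF A] lessThan_iff ij)
  finally show ?thesis
    using mexp_has_derivative_series[OF assms, of t] by simp
qed

lemma mexp_has_derivative_left:
  fixes A :: "real mat"
  assumes A: "A \<in> carrier_mat n n" and ij: "i < n" "j < n"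
  shows "((\<lambda>t. mexp (t \<cdot>\<^sub>m A) $$ (i, j)) has_real_derivative
           (\<Sum>l<n. A $$ (i, l) * mexp (t \<cdot>\<^sub>m A) $$ (l, j))) (at t)"
proof -
  have "(\<Sum>k. (A ^\<^sub>m Suc k) $$ (i, j) / fact k * t ^ k) =
        (\<Sum>k. \<Sum>l<n. A $$ (i, l) * ((A ^\<^sub>m k) $$ (l, j) / fact k * t ^ k))"
    using A ij by (simp add: pow_mat_Suc_left[OF A] index_mult_mat_sum[of _ n n _ n] 
      sum_distrib_left sum_distrib_right sum_divide_distrib mult_ac
      del: index_mult_mat pow_mat.simps)
  also have "\<dots> = (\<Sum>l<n. \<Sum>k. A $$ (i, l) * ((A ^\<^sub>m k) $$ (l, j) / fact k * t ^ k))"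
    using A ij by (intro suminf_sum summable_mult summable_mexp_series[of A n]) auto
  also have "\<dots> = (\<Sum>l<n. A $$ (i, l) * mexp (t \<cdot>\<^sub>m A) $$ (l, j))"
    by (intro sum.cong refl) (simp only: mexp_smult_index[OF A] suminf_mult
      summable_mexp_series[OF A] lessThan_iff ij)
  finally show ?thesis
    using mexp_has_derivative_series[OF assms, of t] by simp
qed

text \<open>
  Solutions of \<open>u' = u A\<close> are \<open>u(0) e\<^bsup>At\<^esup>\<close>, because \<open>s \<mapsto> u(t - s) e\<^bsup>As\<^esup>\<close> is constant. Uniqueness replaces
  all computations with powers of block matrices below: a block of an exponential is identified by
  checking that the proposed value solves the same equation.
\<close>

lemma linear_ode_unique:
  fixes A :: "real mat" and u :: "real \<Rightarrow> nat \<Rightarrow> real"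
  assumes A: "A \<in> carrier_mat n n"
    and u: "\<And>t j. j < n \<Longrightarrow> ((\<lambda>s. u s j) has_real_derivative (\<Sum>l<n. u t l * A $$ (l, j))) (at t)"
    and j: "j < n"
  shows "u t j = (\<Sum>l<n. u 0 l * mexp (t \<cdot>\<^sub>m A) $$ (l, j))"
proof -
  \<comment> \<open>Constant, with value \<open>u(t)\<close> at \<open>0\<close> and the right-hand side at \<open>t\<close>.\<close>
  define v where "v s = (\<Sum>l<n. u (t - s) l * mexp (s \<cdot>\<^sub>m A) $$ (l, j))" for s
  have "(v has_real_derivative 0) (at s)" for s
  proof -
    have u': "((\<lambda>s. u (t - s) l) has_real_derivative - (\<Sum>i<n. u (t - s) i * A $$ (i, l))) (at s)"
      if "l < n" for l
    proof -
      have "((\<lambda>s. t - s) has_real_derivative - 1) (at s)"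
        by (auto intro!: derivative_eq_intros)
      from DERIV_chain2[where g = "\<lambda>s. t - s" and x = s and s = UNIV, OF u[OF that, of "t - s"] this]
      show ?thesis by simp
    qed
    have "(v has_real_derivative
        (\<Sum>l<n. - (\<Sum>i<n. u (t - s) i * A $$ (i, l)) * mexp (s \<cdot>\<^sub>m A) $$ (l, j) +
               (\<Sum>i<n. A $$ (l, i) * mexp (s \<cdot>\<^sub>m A) $$ (i, j)) * u (t - s) l)) (at s)"
      unfolding v_def using A j
      by (intro DERIV_sum DERIV_mult u' mexp_has_derivative_left) auto
    moreover have "(\<Sum>l<n. (\<Sum>i<n. u (t - s) i * A $$ (i, l)) * mexp (s \<cdot>\<^sub>m A) $$ (l, j)) =
        (\<Sum>l<n. (\<Sum>i<n. A $$ (l, i) * mexp (s \<cdot>\<^sub>m A) $$ (i, j)) * u (t - s) l)"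
      unfolding sum_distrib_right by (subst sum.swap) (simp add: mult_ac)
    ultimately show ?thesis
      by (simp add: sum_subtractf)
  qed
  then have "v t = v 0"
    by (intro DERIV_isconst_all) auto
  moreover have "v 0 = u t j"
    using A j by (simp add: v_def mexp_0_index[of A n] if_distrib cong: if_cong)
  moreover have "v t = (\<Sum>l<n. u 0 l * mexp (t \<cdot>\<^sub>m A) $$ (l, j))"
    by (simp add: v_def)
  ultimately show ?thesis by simp
qed

section \<open>The exponential of an augmented matrix\<close>

lemma sum_blocks:
  fixes f :: "nat \<Rightarrow> 'a :: comm_monoid_add"
  shows "(\<Sum>q<n * p. f q) = (\<Sum>c<n. \<Sum>l<p. f (c * p + l))"
proof -
  have "sum f {c * p..<c * p + p} = (\<Sum>l<p. f (c * p + l))" for c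
    using sum.shift_bounds_nat_ivl[of f 0 "c * p" p] by (simp add: lessThan_atLeast0 add.commute)
  then show ?thesis
    by (simp add: sum.nat_group[symmetric])
qed

lemma aug_mat_carrier:
 "A \<in> carrier_mat p p \<Longrightarrow> aug_mat N \<theta> A \<in> carrier_mat ((N + 1) * p) ((N + 1) * p)"
  by (auto simp: aug_mat_def Let_def)

lemma block_index_less:
  fixes b N l p :: nat
  assumes "b \<le> N" "l < p"
  shows "b * p + l < (N + 1) * p"
proof -
  have "b * p + l < (b + 1) * p" using assms(2) by simp
  also have "\<dots> \<le> (N + 1) * p" using assms(1) by (intro mult_le_mono1) simp
  finally show ?thesis .
qed

lemma aug_mat_block_index:
  assumes "A \<in> carrier_mat p p" "b \<le> N" "c \<le> N" "i < p" "j < p"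
  shows "aug_mat N \<theta> A $$ (b * p + i, c * p + j) =
    (if c = b then A $$ (i, j) - (if i = j then \<theta> else 0)
     else if c = Suc b \<and> i = j then 1 else 0)"
proof -
  have "b * p + i < (N + 1) * p" "c * p + j < (N + 1) * p"
    using assms by (intro block_index_less; simp)+
  moreover have "(b * p + i) div p = b" "(b * p + i) mod p = i"
    "(c * p + j) div p = c" "(c * p + j) mod p = j"
    "(p + b * p + j) mod p = j"
    using assms by (auto simp: add.assoc)
  ultimately show ?thesis
    unfolding aug_mat_def Let_def using assms by simp
qed

text \<open>
  With \<open>w\<^sub>b(t) = t\<^bsup>b\<^esup>/b! e\<^bsup>-\<theta>t\<^esup> e\<^bsup>At\<^esup>\<close> the product rule gives \<open>w\<^sub>b' = w\<^sub>b (A - \<theta> I) + w\<^bsub>b-1\<^esub>\<close>, which is the linear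
  equation of the block bidiagonal matrix. The blocks \<open>w\<^sub>0, ..., w\<^sub>N\<close> start from \<open>(I, 0, ..., 0)\<close>, so by
  uniqueness they form the first block row of the exponential.
\<close>

lemma mexp_aug_mat_first_row:
  assumes A: "A \<in> carrier_mat p p" and i: "i < p" and l: "l < p" and b: "b \<le> N"
  shows "mexp (t \<cdot>\<^sub>m aug_mat N \<theta> A) $$ (i, b * p + l) =
    t ^ b / fact b * exp (- \<theta> * t) * mexp (t \<cdot>\<^sub>m A) $$ (i, l)"
proof -
  define n where "n = (N + 1) * p"
  define u where "u t j = t ^ (j div p) / fact (j div p) * exp (- \<theta> * t) * mexp (t \<cdot>\<^sub>m A) $$ (i, j mod p)"
    for t j
  have aug: "aug_mat N \<theta> A \<in> carrier_mat n n"
    unfolding n_def by (rule aug_mat_carrier[OF A])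
  have u_block: "u t (c * p + k) = t ^ c / fact c * exp (- \<theta> * t) * mexp (t \<cdot>\<^sub>m A) $$ (i, k)"
    if "k < p" for t c k
    using that by (simp add: u_def)
  have deriv: "((\<lambda>s. u s j) has_real_derivative (\<Sum>q<n. u t q * aug_mat N \<theta> A $$ (q, j))) (at t)"
    if "j < n" for t j
  proof -
    define c k where "c = j div p" and "k = j mod p"
    have k: "k < p" using i by (simp add: k_def)
    have c: "c \<le> N" using that unfolding n_def c_def
      using less_mult_imp_div_less[of j "N + 1" p] by simp
    have j: "j = c * p + k" by (simp add: c_def k_def)
    have "(\<Sum>q<n. u t q * aug_mat N \<theta> A $$ (q, j)) =
        (\<Sum>d<N + 1. \<Sum>q<p. u t (d * p + q) * aug_mat N \<theta> A $$ (d * p + q, c * p + k))"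
      unfolding n_def j sum_blocks ..
    also have "\<dots> = (\<Sum>d<N + 1. \<Sum>q<p.
        (if d = c then u t (c * p + q) * A $$ (q, k) else 0)
        + (if d = c then if q = k then - \<theta> * u t (c * p + k) else 0 else 0)
        + (if Suc d = c then if q = k then u t (d * p + k) else 0 else 0))"
    proof (intro sum.cong refl)
      fix d q assume "d \<in> {..<N + 1}" "q \<in> {..<p}"
      then have "aug_mat N \<theta> A $$ (d * p + q, c * p + k) =
          (if c = d then A $$ (q, k) - (if q = k then \<theta> else 0)
           else if c = Suc d \<and> q = k then 1 else 0)"
        using A c k by (intro aug_mat_block_index) auto
      then show "u t (d * p + q) * aug_mat N \<theta> A $$ (d * p + q, c * p + k) =
          (if d = c then u t (c * p + q) * A $$ (q, k) else 0)
          + (if d = c then if q = k then - \<theta> * u t (c * p + k) else 0 else 0)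
          + (if Suc d = c then if q = k then u t (d * p + k) else 0 else 0)"
        by (simp add: algebra_simps)
    qed
    also have "\<dots> = (\<Sum>q<p. u t (c * p + q) * A $$ (q, k)) - \<theta> * u t (c * p + k)
        + (if c = 0 then 0 else u t ((c - 1) * p + k))"
    proof -
      have "(\<Sum>d<N + 1. if Suc d = c then u t (d * p + k) else 0) =
            (if c = 0 then 0 else u t ((c - 1) * p + k))"
        using c by (cases c) auto
      moreover have "(\<Sum>d<N + 1. \<Sum>q<p. if d = c then f q else 0) = (\<Sum>q<p. f q)" for f :: "nat \<Rightarrow> real"
        using c by (subst sum.swap) (simp del: sum.lessThan_Suc)
      moreover have "(\<Sum>q<p. if P then if q = k then x else 0 else 0) = (if P then x else 0)" for P and x :: real
        using k by simp
      moreover have "(\<Sum>d<N + 1. if d = c then - \<theta> * u t (c * p + k) else 0) = - \<theta> * u t (c * p + k)"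
        using c by simp
      ultimately show ?thesis
        unfolding sum.distrib by simp
    qed
    also have "(\<Sum>q<p. u t (c * p + q) * A $$ (q, k)) =
        t ^ c / fact c * exp (- \<theta> * t) * (\<Sum>q<p. mexp (t \<cdot>\<^sub>m A) $$ (i, q) * A $$ (q, k))"
      by (simp add: u_block sum_distrib_left mult_ac)
    finally have sum_eq: "(\<Sum>q<n. u t q * aug_mat N \<theta> A $$ (q, j)) = \<dots> - \<theta> * u t (c * p + k)
        + (if c = 0 then 0 else u t ((c - 1) * p + k))" .
    have "((\<lambda>s. s ^ c / fact c) has_real_derivative (if c = 0 then 0 else t ^ (c - 1) / fact (c - 1))) (at t)"
    proof (cases c)
      case (Suc d)
      show ?thesis
        using DERIV_cdivide[OF DERIV_pow[of "Suc d" t], of "fact (Suc d)"]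
        by (simp add: Suc del: of_nat_Suc)
    qed simp
    moreover have "((\<lambda>s. exp (- \<theta> * s)) has_real_derivative - \<theta> * exp (- \<theta> * t)) (at t)"
      by (auto intro!: derivative_eq_intros)
    ultimately have "((\<lambda>s. u s (c * p + k)) has_real_derivative
        (((if c = 0 then 0 else t ^ (c - 1) / fact (c - 1)) * exp (- \<theta> * t) +
          - \<theta> * exp (- \<theta> * t) * (t ^ c / fact c)) * mexp (t \<cdot>\<^sub>m A) $$ (i, k) +
         (\<Sum>q<p. mexp (t \<cdot>\<^sub>m A) $$ (i, q) * A $$ (q, k)) * (t ^ c / fact c * exp (- \<theta> * t)))) (at t)"
      unfolding u_block[OF k]
      by (intro DERIV_mult mexp_has_derivative_right[OF A i k])
    then show ?thesis
      unfolding sum_eq unfolding j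
      by (rule back_subst[where P = "\<lambda>x. (_ has_real_derivative x) _"])
        (simp only: u_block[OF k], simp add: algebra_simps)
  qed
  have j: "b * p + l < n"
    unfolding n_def by (rule block_index_less[OF b l])
  have u0: "u 0 q = (if q = i then 1 else 0)" if "q < n" for q
  proof (cases "q < p")
    case True
    then show ?thesis using A i by (simp add: u_def mexp_0_index[of A p])
  next
    case False
    then have "q div p \<noteq> 0" "q \<noteq> i" using i by (auto simp: div_eq_0_iff)
    then show ?thesis by (simp add: u_def)
  qed
  have "i < n" using i by (simp add: n_def)
  have "u t (b * p + l) = (\<Sum>q<n. u 0 q * mexp (t \<cdot>\<^sub>m aug_mat N \<theta> A) $$ (q, b * p + l))"
    by (rule linear_ode_unique[OF aug deriv j])
  also have "\<dots> = (\<Sum>q<n. if q = i then mexp (t \<cdot>\<^sub>m aug_mat N \<theta> A) $$ (i, b * p + l) else 0)"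
    by (intro sum.cong) (auto simp: u0)
  also have "\<dots> = mexp (t \<cdot>\<^sub>m aug_mat N \<theta> A) $$ (i, b * p + l)"
    using \<open>i < n\<close> by simp
  finally show ?thesis by (simp add: u_block[OF l])
qed

section \<open>Convergent integrals of matrix exponentials\<close>

text \<open>
  The easy direction of Hake's theorem for a half-line.
\<close>

lemma has_integral_atLeast_tendsto:
  fixes f :: "real \<Rightarrow> real"
  assumes "(f has_integral I) {a..}"
  shows "((\<lambda>x. integral {a..x} f) \<longlongrightarrow> I) at_top"
proof (rule tendstoI)
  fix e :: real assume "0 < e"
  then obtain B where B: "0 < B" "\<And>c d. ball 0 B \<subseteq> cbox c d \<Longrightarrow>
      norm (integral (cbox c d) (\<lambda>x. if x \<in> {a..} then f x else 0) - I) < e"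
    using assms unfolding has_integral_alt'[of f] by metis
  have "dist (integral {a..x} f) I < e" if x: "max B a \<le> x" for x
  proof -
    \<comment> \<open>Integrability is stated for intervals that contain a large ball, so the interval is extended
      to the left of \<open>a\<close>, where the restricted integrand is \<open>0\<close>.\<close>
    define c where "c = min a (- B)"
    have "ball 0 B \<subseteq> cbox c x"
      using x by (auto simp: c_def dist_real_def)
    moreover have "integral (cbox c x) (\<lambda>x. if x \<in> {a..} then f x else 0) = integral {a..x} f"
    proof -
      have "{a..} \<inter> cbox c x = {a..x}" by (auto simp: c_def)
      then show ?thesis by (simp only: integral_restrict_Int)
    qed
    ultimately show ?thesis using B(2)[of c x] by (simp add: dist_norm)
  qed
  then show "eventually (\<lambda>x. dist (integral {a..x} f) I < e) at_top"
    unfolding eventually_at_top_linorder by blast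
qed

text \<open>
  By L'Hospital's rule \<open>d\<close> is the limit of \<open>f x / x\<close>, which is \<open>0\<close> since \<open>f\<close> is bounded near infinity.
\<close>

lemma limit_of_derivative_eq_0:
  fixes f f' :: "real \<Rightarrow> real"
  assumes f: "\<And>x. (f has_real_derivative f' x) (at x)"
    and c: "(f \<longlongrightarrow> c) at_top" and d: "(f' \<longlongrightarrow> d) at_top"
  shows "d = 0"
proof -
  have "((\<lambda>x. f x / x) \<longlongrightarrow> d) at_top"
  proof (rule lhospital_at_top_at_top)
    show "((\<lambda>x. f' x / 1) \<longlongrightarrow> d) at_top" using d by simp
  qed (auto intro!: always_eventually f filterlim_ident DERIV_ident)
  moreover have "((\<lambda>x. f x / x) \<longlongrightarrow> 0) at_top"
    by (rule real_tendsto_divide_at_top[OF c filterlim_ident])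
  ultimately show ?thesis
    using tendsto_unique trivial_limit_at_top_linorder by blast
qed

lemma minv_uminus:
  fixes A :: "real mat"
  assumes A: "A \<in> carrier_mat n n" and inv: "invertible_mat A"
  shows "minv (- A) \<in> carrier_mat n n" "- A * minv (- A) = 1\<^sub>m n" "minv (- A) * - A = 1\<^sub>m n"
proof -
  obtain B where B: "A * B = 1\<^sub>m n" "B * A = 1\<^sub>m n"
    using inv A by (metis carrier_matD index_mult_mat(2,3) index_one_mat(2,3) inverts_mat_def invertible_mat_def)
  have Bc: "B \<in> carrier_mat n n"
    using B A by (metis carrier_matD carrier_matI index_mult_mat(2,3) index_one_mat(2,3))
  have mA: "- A \<in> carrier_mat n n" "- B \<in> carrier_mat n n" using A Bc by auto
  have "- A * - B = 1\<^sub>m n" "- B * - A = 1\<^sub>m n"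
    using A Bc B by auto
  then have "- A \<in> Units (ring_mat TYPE(real) n ())"
    using mA unfolding Units_def ring_mat_def by (auto intro!: bexI[of _ "- B"])
  then obtain C where "mat_inverse (- A) = Some C"
    using mat_inverse(1)[OF mA(1)] by fastforce
  with mat_inverse(2)[OF mA(1) this]
  show "minv (- A) \<in> carrier_mat n n" "- A * minv (- A) = 1\<^sub>m n" "minv (- A) * - A = 1\<^sub>m n"
    by (auto simp: minv_def)
qed

lemma mexp_antiderivative:
  fixes A :: "real mat"
  assumes A: "A \<in> carrier_mat n n" and inv: "invertible_mat A" and ij: "i < n" "j < n"
  shows "((\<lambda>t. (mexp (t \<cdot>\<^sub>m A) * minv (- A)) $$ (i, j)) has_real_derivative
    - (mexp (t \<cdot>\<^sub>m A) $$ (i, j))) (at t)"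
proof -
  note B = minv_uminus[OF A inv]
  have E: "mexp (s \<cdot>\<^sub>m A) \<in> carrier_mat n n" for s using A by simp
  have "((\<lambda>t. \<Sum>l<n. mexp (t \<cdot>\<^sub>m A) $$ (i, l) * minv (- A) $$ (l, j)) has_real_derivative
      (\<Sum>l<n. (mexp (t \<cdot>\<^sub>m A) * A) $$ (i, l) * minv (- A) $$ (l, j))) (at t)"
    using A ij
    by (intro DERIV_sum DERIV_cmult_right)
       (simp add: index_mult_mat_sum[OF E A] mexp_has_derivative_right del: index_mult_mat)
  moreover have "(\<Sum>l<n. (mexp (t \<cdot>\<^sub>m A) * A) $$ (i, l) * minv (- A) $$ (l, j)) =
      (mexp (t \<cdot>\<^sub>m A) * A * minv (- A)) $$ (i, j)"
    by (rule index_mult_mat_sum[OF mult_carrier_mat[OF E A] B(1) ij, symmetric])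
  moreover have "mexp (t \<cdot>\<^sub>m A) * A * minv (- A) = - mexp (t \<cdot>\<^sub>m A)"
  proof -
    have "A * minv (- A) = - 1\<^sub>m n"
    proof -
      have "- (A * minv (- A)) = 1\<^sub>m n" using A B by simp
      then show ?thesis by (metis uminus_uminus_mat)
    qed
    then show ?thesis
      using A B right_mult_one_mat[OF E[of t]] carrier_matD[OF E[of t]]
      by (simp add: assoc_mult_mat[of _ n n _ n _ n])
  qed
  ultimately show ?thesis
    using A B ij E carrier_matD[OF E[of t]] by (simp add: index_mult_mat_sum[of _ n n _ n] del: index_mult_mat)
qed

text \<open>
  Convergence of the integral says that \<open>J(t) = e\<^bsup>At\<^esup> (-A)\<^sup>-\<^sup>1\<close>, an antiderivative of \<open>-e\<^bsup>At\<^esup>\<close>, has a limit.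
  Then \<open>e\<^bsup>At\<^esup> = -J(t) A\<close> has a limit too, and as the derivative of a convergent function it can only tend
  to \<open>0\<close>. Therefore \<open>J(t)\<close>, which is \<open>e\<^bsup>At\<^esup>\<close> times a constant matrix, tends to \<open>0\<close> as well.
\<close>

lemma mexp_antiderivative_tendsto_0:
  fixes A :: "real mat"
  assumes A: "A \<in> carrier_mat n n" and inv: "invertible_mat A"
    and conv: "exp_integral_converges A y" and ij: "i < n" "j < n"
  shows "((\<lambda>t. (mexp (t \<cdot>\<^sub>m A) * minv (- A)) $$ (i, j)) \<longlongrightarrow> 0) at_top"
proof -
  note B = minv_uminus[OF A inv]
  have E: "mexp (s \<cdot>\<^sub>m A) \<in> carrier_mat n n" for s using A by simp
  define J where "J j t = (mexp (t \<cdot>\<^sub>m A) * minv (- A)) $$ (i, j)" for j t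
  define H where "H j t = mexp (t \<cdot>\<^sub>m A) $$ (i, j)" for j t
  have J': "(J j has_real_derivative - H j t) (at t)" if "j < n" for j t
    unfolding J_def H_def by (rule mexp_antiderivative[OF A inv ij(1) that])
  have J_lim: "\<exists>c. (J j \<longlongrightarrow> c) at_top" if j: "j < n" for j
  proof -
    obtain I where "(H j has_integral I) {y..}"
      using conv A ij(1) j unfolding exp_integral_converges_def H_def[abs_def] integrable_on_def by auto
    then have lim: "((\<lambda>x. J j y - integral {y..x} (H j)) \<longlongrightarrow> J j y - I) at_top"
      by (intro tendsto_diff tendsto_const has_integral_atLeast_tendsto)
    have "eventually (\<lambda>x. J j y - integral {y..x} (H j) = J j x) at_top"
      using eventually_ge_at_top[of y]
    proof eventually_elim
      case (elim x)
      have "((\<lambda>t. - H j t) has_integral J j x - J j y) {y..x}"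
        using elim J'[OF j] by (intro fundamental_theorem_of_calculus)
          (auto simp: has_real_derivative_iff_has_vector_derivative[symmetric] intro: has_field_derivative_at_within)
      from has_integral_neg[OF this] show ?case by (simp add: integral_unique)
    qed
    with lim have "(J j \<longlongrightarrow> J j y - I) at_top"
      by (rule Lim_transform_eventually)
    then show ?thesis ..
  qed
  have H_lim: "\<exists>c. (H j \<longlongrightarrow> c) at_top" if j: "j < n" for j
  proof -
    obtain c where c: "\<And>l. l < n \<Longrightarrow> (J l \<longlongrightarrow> c l) at_top" using J_lim by metis
    have BA: "minv (- A) * A = - 1\<^sub>m n"
    proof -
      have "- (minv (- A) * A) = 1\<^sub>m n" using A B by simp
      then show ?thesis by (metis uminus_uminus_mat)
    qed
    have "H j = (\<lambda>t. - (\<Sum>l<n. J l t * A $$ (l, j)))"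
    proof
      fix t
      have "(\<Sum>l<n. J l t * A $$ (l, j)) = (mexp (t \<cdot>\<^sub>m A) * minv (- A) * A) $$ (i, j)"
        unfolding J_def
        by (rule index_mult_mat_sum[OF mult_carrier_mat[OF E B(1)] A ij(1) j, symmetric])
      also have "\<dots> = (- mexp (t \<cdot>\<^sub>m A)) $$ (i, j)"
        using A B right_mult_one_mat[OF E[of t]] carrier_matD[OF E[of t]] BA
        by (simp add: assoc_mult_mat[of _ n n _ n _ n])
      also have "\<dots> = - H j t" using E[of t] ij j by (simp add: H_def)
      finally show "H j t = - (\<Sum>l<n. J l t * A $$ (l, j))" by simp
    qed
    moreover have "((\<lambda>t. - (\<Sum>l<n. J l t * A $$ (l, j))) \<longlongrightarrow> - (\<Sum>l<n. c l * A $$ (l, j))) at_top"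
      by (intro tendsto_intros c) auto
    ultimately show ?thesis by auto
  qed
  have H_0: "(H j \<longlongrightarrow> 0) at_top" if j: "j < n" for j
  proof -
    obtain c d where "(J j \<longlongrightarrow> c) at_top" "(H j \<longlongrightarrow> d) at_top"
      using J_lim H_lim j by metis
    moreover from limit_of_derivative_eq_0[OF J'[OF j] this(1) tendsto_minus[OF this(2)]]
    have "d = 0" by simp
    ultimately show ?thesis by simp
  qed
  have "((\<lambda>t. \<Sum>l<n. H l t * minv (- A) $$ (l, j)) \<longlongrightarrow> (\<Sum>l<n. 0 * minv (- A) $$ (l, j))) at_top"
    by (intro tendsto_intros H_0) auto
  then show ?thesis
    using A B ij E by (simp add: H_def index_mult_mat_sum[of _ n n _ n] del: index_mult_mat)
qed

section \<open>Exit times of right-continuous paths\<close>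

text \<open>
  Right-continuity for functions with values in a discrete space, on nonnegative times.
\<close>

definition right_constant :: "(real \<Rightarrow> 'a) \<Rightarrow> bool" where
  "right_constant x \<longleftrightarrow> (\<forall>t\<ge>0. \<exists>\<epsilon>>0. \<forall>s\<in>{t..<t + \<epsilon>}. x s = x t)"

lemma right_constantE:
  assumes "right_constant x" "0 \<le> t"
  obtains \<epsilon> where "0 < \<epsilon>" "\<And>s. t \<le> s \<Longrightarrow> s < t + \<epsilon> \<Longrightarrow> x s = x t"
  using assms unfolding right_constant_def by (meson atLeastLessThan_iff)

lemma exit_time_nonneg: "0 \<le> exit_time S X \<omega>"
  unfolding exit_time_def by (auto intro: cInf_greatest)

lemma exit_time_le: "0 \<le> t \<Longrightarrow> X t \<omega> \<notin> S \<Longrightarrow> exit_time S X \<omega> \<le> t"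
  unfolding exit_time_def by (auto intro!: cInf_lower bdd_belowI[of _ 0])

text \<open>
  Were the path still in \<open>S\<close> at the infimum, right-continuity would keep it there for a while longer.
\<close>

lemma exit_time_attained:
  assumes rc: "right_constant (\<lambda>t. X t \<omega>)"
    and exit: "0 \<le> t" "X t \<omega> \<notin> S"
  shows "X (exit_time S X \<omega>) \<omega> \<notin> S"
proof
  define \<tau> where "\<tau> = exit_time S X \<omega>"
  assume "X (exit_time S X \<omega>) \<omega> \<in> S"
  moreover obtain \<epsilon> where \<epsilon>: "0 < \<epsilon>" "\<And>s. \<tau> \<le> s \<Longrightarrow> s < \<tau> + \<epsilon> \<Longrightarrow> X s \<omega> = X \<tau> \<omega>"
    using right_constantE[OF rc exit_time_nonneg[of S X \<omega>]] unfolding \<tau>_def by blast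
  ultimately have stay: "X s \<omega> \<in> S" if "\<tau> \<le> s" "s < \<tau> + \<epsilon>" for s
    using that unfolding \<tau>_def by metis
  have "\<tau> + \<epsilon> \<le> s" if "0 \<le> s" "X s \<omega> \<notin> S" for s
    using stay[of s] exit_time_le[of s X \<omega> S] that unfolding \<tau>_def by force
  then have "\<tau> + \<epsilon> \<le> Inf {t. 0 \<le> t \<and> X t \<omega> \<notin> S}"
    using exit by (intro cInf_greatest) auto
  also have "\<dots> = \<tau>"
    using exit unfolding \<tau>_def exit_time_def by auto
  finally show False using \<epsilon>(1) by simp
qed

lemma exit_time_pos_left:
  assumes rc: "right_constant (\<lambda>t. X t \<omega>)"
    and "0 < exit_time S X \<omega>"
  shows "X (exit_time S X \<omega>) \<omega> \<notin> S"
proof -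
  have "\<exists>t\<ge>0. X t \<omega> \<notin> S"
    using assms(2) unfolding exit_time_def by (auto split: if_splits)
  then show ?thesis using exit_time_attained[of X \<omega>, OF rc] by blast
qed

lemma rational_witness:
  fixes x :: "real \<Rightarrow> 'a"
  assumes rc: "right_constant x" and t: "0 \<le> t" and u: "t < u"
  obtains q where "q \<in> \<rat>" "t < q" "q < u" "x q = x t"
proof -
  obtain \<epsilon> where \<epsilon>: "0 < \<epsilon>" "\<And>s. t \<le> s \<Longrightarrow> s < t + \<epsilon> \<Longrightarrow> x s = x t"
    using right_constantE[OF rc t] by blast
  obtain q where "q \<in> \<rat>" "t < q" "q < min u (t + \<epsilon>)"
    using Rats_dense_in_real[of t "min u (t + \<epsilon>)"] u \<epsilon>(1) by auto
  then show ?thesis using that[of q] \<epsilon>(2)[of q] by auto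
qed

text \<open>
  The event of a late exit is a countable combination of events at fixed times: by right-continuity,
  a path that leaves \<open>S\<close> is outside \<open>S\<close> at some rational time, and a path that leaves \<open>S\<close> before \<open>t\<close> is
  outside \<open>S\<close> at some rational time before \<open>t\<close>. The first conjunct excludes paths that never leave, whose
  exit time has the default value \<open>0\<close>.
\<close>

lemma exit_time_greater_iff:
  assumes rc: "right_constant (\<lambda>t. X t \<omega>)" and t: "0 \<le> t"
  shows "t < exit_time S X \<omega> \<longleftrightarrow>
    (\<exists>q\<in>\<rat> \<inter> {0..}. X q \<omega> \<notin> S) \<and> (\<forall>q\<in>insert t (\<rat> \<inter> {0..t}). X q \<omega> \<in> S)"
proof (intro iffI conjI ballI)
  assume gt: "t < exit_time S X \<omega>"
  then have "X (exit_time S X \<omega>) \<omega> \<notin> S"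
    using t by (intro exit_time_pos_left[of X \<omega>, OF rc]) auto
  then show "\<exists>q\<in>\<rat> \<inter> {0..}. X q \<omega> \<notin> S"
    using rational_witness[OF rc exit_time_nonneg, of S X \<omega> "exit_time S X \<omega> + 1"]
      exit_time_nonneg[of S X \<omega>]
    by (metis IntI atLeast_iff less_add_one less_eq_real_def order_trans)
  fix q assume "q \<in> insert t (\<rat> \<inter> {0..t})"
  then show "X q \<omega> \<in> S"
    using gt t exit_time_le[of q X \<omega> S] by force
next
  assume R: "(\<exists>q\<in>\<rat> \<inter> {0..}. X q \<omega> \<notin> S) \<and> (\<forall>q\<in>insert t (\<rat> \<inter> {0..t}). X q \<omega> \<in> S)"
  then have stay: "\<forall>q\<in>insert t (\<rat> \<inter> {0..t}). X q \<omega> \<in> S" by blast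
  from R obtain q where q: "q \<in> {0..}" "X q \<omega> \<notin> S" by blast
  let ?\<tau> = "exit_time S X \<omega>"
  have left: "X ?\<tau> \<omega> \<notin> S"
    using q by (intro exit_time_attained[of X \<omega>, OF rc, of q]) auto
  show "t < ?\<tau>"
  proof (rule ccontr)
    assume "\<not> t < ?\<tau>"
    moreover have "?\<tau> \<noteq> t" using left stay by auto
    ultimately have "?\<tau> < t" by simp
    then obtain r where r: "r \<in> \<rat>" "?\<tau> < r" "r < t" "X r \<omega> = X ?\<tau> \<omega>"
      using rational_witness[OF rc exit_time_nonneg, of S X \<omega> t] by metis
    then have "r \<in> insert t (\<rat> \<inter> {0..t})"
      using exit_time_nonneg[of S X \<omega>] by auto
    then show False
      using stay left r(4) by metis
  qed
qed

lemma countable_Rats_Int: "countable (\<rat> \<inter> A)"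
  using countable_rat by (rule countable_subset[rotated]) auto

lemma borel_measurable_exit_time:
  assumes rc: "\<And>\<omega>. \<omega> \<in> space N \<Longrightarrow> right_constant (\<lambda>t. X t \<omega>)"
    and meas: "\<And>t. 0 \<le> t \<Longrightarrow> X t \<in> N \<rightarrow>\<^sub>M count_space UNIV"
  shows "exit_time S X \<in> borel_measurable N"
  unfolding borel_measurable_iff_greater
proof
  fix t :: real
  show "{\<omega> \<in> space N. t < exit_time S X \<omega>} \<in> sets N"
  proof (cases "0 \<le> t")
    case True
    have X: "X q -` B \<inter> space N \<in> sets N" if "0 \<le> q" for q B
      using measurable_sets[OF meas[OF that]] by simp
    have "{\<omega> \<in> space N. t < exit_time S X \<omega>} =
        (\<Union>q\<in>\<rat> \<inter> {0..}. X q -` (- S) \<inter> space N) \<inter>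
        (\<Inter>q\<in>insert t (\<rat> \<inter> {0..t}). X q -` S \<inter> space N)"
    proof -
      have "t < exit_time S X \<omega> \<longleftrightarrow>
          (\<exists>q\<in>\<rat> \<inter> {0..}. X q \<omega> \<notin> S) \<and> (\<forall>q\<in>insert t (\<rat> \<inter> {0..t}). X q \<omega> \<in> S)"
        if "\<omega> \<in> space N" for \<omega>
        by (rule exit_time_greater_iff[of X \<omega>, OF rc[OF that] True])
      then show ?thesis by auto
    qed
    also have "\<dots> \<in> sets N"
      using True by (intro sets.Int sets.countable_UN' sets.countable_INT' countable_insert
        countable_Rats_Int image_subsetI X) auto
    finally show ?thesis .
  next
    case False
    then have "{\<omega> \<in> space N. t < exit_time S X \<omega>} = space N"
      by (auto intro: less_le_trans[OF _ exit_time_nonneg])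
    then show ?thesis by simp
  qed
qed

text \<open>
  The exit time \<open>\<tau>\<close> is approximated strictly from above by \<open>\<tau>\<^sub>n = (\<lfloor>(n + 1) \<tau>\<rfloor> + 1) / (n + 1)\<close>, which takes
  countably many values. Thus the state at time \<open>\<tau>\<^sub>n\<close> is measurable, and by right-continuity it is
  eventually the state at time \<open>\<tau>\<close>.
\<close>

lemma measurable_exit_state:
  assumes rc: "\<And>\<omega>. \<omega> \<in> space N \<Longrightarrow> right_constant (\<lambda>t. X t \<omega>)"
    and meas: "\<And>t. 0 \<le> t \<Longrightarrow> X t \<in> N \<rightarrow>\<^sub>M count_space UNIV"
  shows "{\<omega> \<in> space N. X (exit_time S X \<omega>) \<omega> = c} \<in> sets N"
proof -
  note [measurable] = borel_measurable_exit_time[OF rc meas, where S = S]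
  define \<tau> where "\<tau> n \<omega> = (real (nat \<lfloor>real (Suc n) * exit_time S X \<omega>\<rfloor>) + 1) / real (Suc n)" for n \<omega>
  have [measurable]: "(\<lambda>\<omega>. X (\<tau> n \<omega>) \<omega>) \<in> N \<rightarrow>\<^sub>M count_space UNIV" for n
    unfolding \<tau>_def
    by (rule measurable_compose_countable[where f = "\<lambda>k. X ((real k + 1) / real (Suc n))"
          and g = "\<lambda>\<omega>. nat \<lfloor>real (Suc n) * exit_time S X \<omega>\<rfloor>"]) (auto intro!: meas)
  have bounds: "exit_time S X \<omega> < \<tau> n \<omega>" "\<tau> n \<omega> \<le> exit_time S X \<omega> + inverse (real (Suc n))" for n \<omega>
  proof -
    have eq: "real (nat \<lfloor>real (Suc n) * exit_time S X \<omega>\<rfloor>) = of_int \<lfloor>real (Suc n) * exit_time S X \<omega>\<rfloor>"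
      using exit_time_nonneg[of S X \<omega>] by simp
    have "real (Suc n) * exit_time S X \<omega> < of_int \<lfloor>real (Suc n) * exit_time S X \<omega>\<rfloor> + 1"
      "of_int \<lfloor>real (Suc n) * exit_time S X \<omega>\<rfloor> \<le> real (Suc n) * exit_time S X \<omega>"
      by linarith+
    then show "exit_time S X \<omega> < \<tau> n \<omega>" "\<tau> n \<omega> \<le> exit_time S X \<omega> + inverse (real (Suc n))"
      unfolding \<tau>_def eq by (simp_all add: field_simps del: of_nat_Suc)
  qed
  have ev: "\<exists>n0. \<forall>n\<ge>n0. X (\<tau> n \<omega>) \<omega> = X (exit_time S X \<omega>) \<omega>" if \<omega>: "\<omega> \<in> space N" for \<omega>
  proof -
    obtain \<epsilon> where \<epsilon>: "0 < \<epsilon>"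
      "\<And>s. exit_time S X \<omega> \<le> s \<Longrightarrow> s < exit_time S X \<omega> + \<epsilon> \<Longrightarrow> X s \<omega> = X (exit_time S X \<omega>) \<omega>"
      using right_constantE[OF rc[OF \<omega>] exit_time_nonneg[of S X \<omega>]] by blast
    obtain n0 where n0: "inverse (real (Suc n0)) < \<epsilon>"
      using reals_Archimedean[OF \<epsilon>(1)] by blast
    have "X (\<tau> n \<omega>) \<omega> = X (exit_time S X \<omega>) \<omega>" if "n0 \<le> n" for n
    proof (rule \<epsilon>(2))
      have "inverse (real (Suc n)) \<le> inverse (real (Suc n0))"
        using that by (intro le_imp_inverse_le) auto
      then show "exit_time S X \<omega> \<le> \<tau> n \<omega>" "\<tau> n \<omega> < exit_time S X \<omega> + \<epsilon>"
        using bounds[where n = n and \<omega> = \<omega>] n0 by linarith+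
    qed
    then show ?thesis by blast
  qed
  have "{\<omega> \<in> space N. X (exit_time S X \<omega>) \<omega> = c} = {\<omega> \<in> space N. \<exists>n0. \<forall>n\<ge>n0. X (\<tau> n \<omega>) \<omega> = c}"
  proof -
    have "(\<exists>n0. \<forall>n\<ge>n0. X (\<tau> n \<omega>) \<omega> = c) \<longleftrightarrow> X (exit_time S X \<omega>) \<omega> = c" if "\<omega> \<in> space N" for \<omega>
      using ev[OF that] by (metis nle_le)
    then show ?thesis by blast
  qed
  also have "\<dots> \<in> sets N" by measurable
  finally show ?thesis .
qed

lemma jump_process_right_continuous:
  "jump_process M n X \<Longrightarrow> \<omega> \<in> space M \<Longrightarrow> right_constant (\<lambda>t. X t \<omega>)"
  unfolding jump_process_def right_constant_def by blast

lemma jump_process_measurable: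
  assumes "jump_process M n X" "0 \<le> t"
  shows "X t \<in> M \<rightarrow>\<^sub>M count_space UNIV"
proof -
  have "X t \<in> M \<rightarrow>\<^sub>M count_space {..<n}" using assms unfolding jump_process_def by blast
  then have "(\<lambda>\<omega>. (\<lambda>i. i) (X t \<omega>)) \<in> M \<rightarrow>\<^sub>M count_space UNIV"
    by (rule measurable_compose) simp
  then show ?thesis by simp
qed

lemma jump_process_less:
  assumes "jump_process M n X" "0 \<le> t" "\<omega> \<in> space M"
  shows "X t \<omega> < n"
proof -
  have "X t \<in> M \<rightarrow>\<^sub>M count_space {..<n}" using assms unfolding jump_process_def by blast
  from measurable_space[OF this assms(3)] show ?thesis by simp
qed

lemma jump_process_sets:
  assumes "jump_process M n X" "0 \<le> s" "0 \<le> t"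
  shows "{\<omega> \<in> space M. X s \<omega> = i} \<in> sets M" "{\<omega> \<in> space M. X s \<omega> = i \<and> X t \<omega> = j} \<in> sets M"
proof -
  note [measurable] = jump_process_measurable[OF assms(1,2)] jump_process_measurable[OF assms(1,3)]
  show "{\<omega> \<in> space M. X s \<omega> = i} \<in> sets M" "{\<omega> \<in> space M. X s \<omega> = i \<and> X t \<omega> = j} \<in> sets M"
    by measurable
qed

text \<open>
  Exit times are functions of the path; this makes the conditional independence of the residual
  processes available for their lifetimes.
\<close>

lemma exit_time_event_in_sigma_events:
  assumes X: "jump_process M n X" and g: "g \<in> borel_measurable borel" and B: "B \<in> sets borel"
  shows "(\<lambda>\<omega>. g (exit_time S X \<omega>)) -` B \<inter> space M \<in> sigma_events M {0..} X"
proof -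
  define G where "G = {X t -` B \<inter> space M | t B. t \<in> {0::real..}}"
  define N where "N = sigma (space M) G"
  have G: "G \<subseteq> Pow (space M)" by (auto simp: G_def)
  have sp: "space N = space M" and se: "sets N = sigma_sets (space M) G"
    using G by (simp_all add: N_def)
  have "exit_time S X \<in> borel_measurable N"
  proof (rule borel_measurable_exit_time)
    show "X t \<in> N \<rightarrow>\<^sub>M count_space UNIV" if "0 \<le> t" for t
    proof (rule measurableI)
      show "X t -` A \<inter> space N \<in> sets N" for A
        unfolding sp se using that by (intro sigma_sets.Basic) (auto simp: G_def)
    qed simp
  qed (use jump_process_right_continuous[OF X] sp in auto)
  from measurable_sets[OF measurable_compose[OF this g] B] show ?thesis
    by (simp add: sp se sigma_events_def G_def)
qed

section \<open>The law of the exit time and the exit state\<close>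

text \<open>
  A process on the transient states \<open>{..<m}\<close> and the absorbing states \<open>m, ..., m + r - 1\<close>. Both the shock
  process (\<open>r = p\<close>) and the residual processes (\<open>r = 1\<close>) have this form.
\<close>

locale absorbed_jump_process = prob_space M
  for M :: "'w measure" and m r :: nat and \<pi> :: "nat \<Rightarrow> real" and T U :: "real mat"
    and X :: "real \<Rightarrow> 'w \<Rightarrow> nat" +
  assumes T: "T \<in> carrier_mat m m" and U: "U \<in> carrier_mat m r"
    and markov: "markov_jump_process M (m + r) \<pi> (shock_intensity m r T U) X"
begin

abbreviation \<Lambda> :: "real mat" where "\<Lambda> \<equiv> shock_intensity m r T U"

abbreviation \<tau> :: "'w \<Rightarrow> real" where "\<tau> \<equiv> exit_time {..<m} X"

text \<open>
  The entry of \<open>\<pi> e\<^bsup>Tt\<^esup> U\<close> that belongs to the absorbing state \<open>m + k\<close>.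
\<close>

definition exit_density :: "nat \<Rightarrow> real \<Rightarrow> real" where
  "exit_density k t = (\<Sum>i<m. \<Sum>l<m. \<pi> i * mexp (t \<cdot>\<^sub>m T) $$ (i, l) * U $$ (l, k))"

lemma \<Lambda>_carrier: "\<Lambda> \<in> carrier_mat (m + r) (m + r)"
  using T U by (simp add: shock_intensity_def)

lemma \<Lambda>_index:
  "i < m + r \<Longrightarrow> j < m + r \<Longrightarrow>
    \<Lambda> $$ (i, j) = (if i < m then if j < m then T $$ (i, j) else U $$ (i, j - m) else 0)"
  using T U by (auto simp: shock_intensity_def)

lemma sum_\<Lambda>_column_transient:
  assumes "j < m"
  shows "(\<Sum>q<m + r. a q * \<Lambda> $$ (q, j)) = (\<Sum>q<m. a q * T $$ (q, j))"
  using assms by (intro sum.mono_neutral_cong_right) (auto simp: \<Lambda>_index)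

lemma sum_\<Lambda>_column_absorbing:
  assumes "k < r"
  shows "(\<Sum>q<m + r. a q * \<Lambda> $$ (q, m + k)) = (\<Sum>q<m. a q * U $$ (q, k))"
  using assms by (intro sum.mono_neutral_cong_right) (auto simp: \<Lambda>_index)

lemma mexp_\<Lambda>_absorbing_row:
  assumes i: "m \<le> i" "i < m + r" and j: "j < m + r"
  shows "mexp (t \<cdot>\<^sub>m \<Lambda>) $$ (i, j) = (if i = j then 1 else 0)"
proof -
  have "((\<lambda>t. mexp (t \<cdot>\<^sub>m \<Lambda>) $$ (i, j)) has_real_derivative 0) (at t)" for t
    using mexp_has_derivative_left[OF \<Lambda>_carrier i(2) j, of t] i by (simp add: \<Lambda>_index)
  then have "mexp (t \<cdot>\<^sub>m \<Lambda>) $$ (i, j) = mexp (0 \<cdot>\<^sub>m \<Lambda>) $$ (i, j)"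
    using DERIV_isconst_all[of "\<lambda>t. mexp (t \<cdot>\<^sub>m \<Lambda>) $$ (i, j)"] by blast
  then show ?thesis using mexp_0_index[OF \<Lambda>_carrier i(2) j] by simp
qed

text \<open>
  The columns of \<open>\<Lambda>\<close> at transient states vanish below \<open>T\<close>, so the transient entries of a row of \<open>e\<^bsup>\<Lambda>t\<^esup>\<close>
  solve the linear equation of \<open>T\<close>.
\<close>

lemma mexp_\<Lambda>_transient_block:
  assumes i: "i < m" and j: "j < m"
  shows "mexp (t \<cdot>\<^sub>m \<Lambda>) $$ (i, j) = mexp (t \<cdot>\<^sub>m T) $$ (i, j)"
proof -
  have "mexp (t \<cdot>\<^sub>m \<Lambda>) $$ (i, j) =
      (\<Sum>l<m. mexp (0 \<cdot>\<^sub>m \<Lambda>) $$ (i, l) * mexp (t \<cdot>\<^sub>m T) $$ (l, j))"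
  proof (rule linear_ode_unique[OF T _ j])
    show "((\<lambda>s. mexp (s \<cdot>\<^sub>m \<Lambda>) $$ (i, l)) has_real_derivative
        (\<Sum>q<m. mexp (t \<cdot>\<^sub>m \<Lambda>) $$ (i, q) * T $$ (q, l))) (at t)" if "l < m" for t l
      using mexp_has_derivative_right[OF \<Lambda>_carrier, of i l t] i that
      by (simp add: sum_\<Lambda>_column_transient)
  qed
  also have "\<dots> = (\<Sum>l<m. if l = i then mexp (t \<cdot>\<^sub>m T) $$ (i, j) else 0)"
    using i by (intro sum.cong refl) (simp add: mexp_0_index[OF \<Lambda>_carrier])
  finally show ?thesis using i by simp
qed

lemma process: "jump_process M (m + r) X"
  using markov by (simp add: markov_jump_process_def)

lemma prob_two_times:
  assumes "0 \<le> s" "0 \<le> h" "i < m + r" "j < m + r"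
  shows "prob {\<omega> \<in> space M. X s \<omega> = i \<and> X (s + h) \<omega> = j} =
    prob {\<omega> \<in> space M. X s \<omega> = i} * mexp (h \<cdot>\<^sub>m \<Lambda>) $$ (i, j)"
proof -
  have "space M \<in> sigma_events M {0..s} X"
    unfolding sigma_events_def by (rule sigma_sets_top)
  then show ?thesis
    using markov assms unfolding markov_jump_process_def by blast
qed

lemma prob_state:
  assumes t: "0 \<le> t" and j: "j < m + r"
  shows "prob {\<omega> \<in> space M. X t \<omega> = j} = (\<Sum>i<m + r. \<pi> i * mexp (t \<cdot>\<^sub>m \<Lambda>) $$ (i, j))"
proof -
  have "prob {\<omega> \<in> space M. X t \<omega> = j} = prob (\<Union>i\<in>{..<m + r}. {\<omega> \<in> space M. X 0 \<omega> = i \<and> X t \<omega> = j})"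
    using jump_process_less[OF process order_refl] by (intro arg_cong[where f = prob]) auto
  also have "\<dots> = (\<Sum>i<m + r. prob {\<omega> \<in> space M. X 0 \<omega> = i \<and> X t \<omega> = j})"
    using jump_process_sets(2)[OF process order_refl t]
    by (intro finite_measure_finite_Union) (auto simp: disjoint_family_on_def)
  also have "\<dots> = (\<Sum>i<m + r. \<pi> i * mexp (t \<cdot>\<^sub>m \<Lambda>) $$ (i, j))"
    using prob_two_times[OF order_refl t _ j] markov
    by (intro sum.cong) (auto simp: markov_jump_process_def)
  finally show ?thesis .
qed

text \<open>
  A transition out of an absorbing state between two fixed times has probability \<open>0\<close>. Countably many
  null events take care of all rational times, and right-continuity of the rest.
\<close>

lemma AE_absorbed:
  "AE \<omega> in M. \<forall>s\<ge>0. \<forall>t\<ge>s. m \<le> X s \<omega> \<longrightarrow> X t \<omega> = X s \<omega>"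
proof -
  have pair: "AE \<omega> in M. m \<le> X q \<omega> \<longrightarrow> X (q + h) \<omega> = X q \<omega>" if q: "0 \<le> q" and h: "0 \<le> h" for q h
  proof -
    have "AE \<omega> in M. \<not> (X q \<omega> = i \<and> X (q + h) \<omega> = j)"
      if "i \<in> {m..<m + r}" "j \<in> {..<m + r} - {i}" for i j
    proof -
      have "prob {\<omega> \<in> space M. X q \<omega> = i \<and> X (q + h) \<omega> = j} = 0"
        using that q h by (subst prob_two_times) (auto simp: mexp_\<Lambda>_absorbing_row)
      moreover have "{\<omega> \<in> space M. X q \<omega> = i \<and> X (q + h) \<omega> = j} \<in> sets M"
        using q h by (intro jump_process_sets(2)[OF process]) auto
      ultimately show ?thesis
        by (simp add: AE_iff_measurable[OF _ refl] emeasure_eq_measure)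
    qed
    then have "AE \<omega> in M. \<forall>i\<in>{m..<m + r}. \<forall>j\<in>{..<m + r} - {i}. \<not> (X q \<omega> = i \<and> X (q + h) \<omega> = j)"
      by (intro AE_ball_countable') auto
    with AE_space show ?thesis
    proof eventually_elim
      case (elim \<omega>)
      have "X q \<omega> < m + r" "X (q + h) \<omega> < m + r"
        using jump_process_less[OF process _ elim(1)] q h by auto
      then show ?case using elim(2) by force
    qed
  qed
  have "AE \<omega> in M. \<forall>q\<in>\<rat> \<inter> {0..}. \<forall>h\<in>\<rat> \<inter> {0..}. m \<le> X q \<omega> \<longrightarrow> X (q + h) \<omega> = X q \<omega>"
    using pair by (intro AE_ball_countable' countable_Rats_Int) auto
  with AE_space show ?thesis
  proof eventually_elim
    case (elim \<omega>)
    have rc: "right_constant (\<lambda>t. X t \<omega>)"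
      by (rule jump_process_right_continuous[OF process elim(1)])
    show ?case
    proof (intro allI impI)
      fix s t assume st: "0 \<le> s" "s \<le> t" "m \<le> X s \<omega>"
      show "X t \<omega> = X s \<omega>"
      proof (cases "s = t")
        case False
        \<comment> \<open>Rational times \<open>q\<close> and \<open>q'\<close> with \<open>s < q < t < q'\<close> at which the path has the values at \<open>s\<close>
          and \<open>t\<close>.\<close>
        then obtain q where q: "q \<in> \<rat>" "s < q" "q < t" "X q \<omega> = X s \<omega>"
          using rational_witness[OF rc st(1), of t] st by auto
        obtain q' where q': "q' \<in> \<rat>" "t < q'" "X q' \<omega> = X t \<omega>"
          using rational_witness[OF rc, of t "t + 1"] st by auto
        have "X (q + (q' - q)) \<omega> = X q \<omega>"
        proof (rule elim(2)[rule_format])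
          show "q \<in> \<rat> \<inter> {0..}" "q' - q \<in> \<rat> \<inter> {0..}" "m \<le> X q \<omega>"
            using q q' st by (auto intro: Rats_diff)
        qed
        then show ?thesis using q q' by simp
      qed simp
    qed
  qed
qed

lemma borel_measurable_\<tau>: "\<tau> \<in> borel_measurable M"
  using jump_process_right_continuous[OF process] jump_process_measurable[OF process]
  by (rule borel_measurable_exit_time)

lemma exit_state_sets: "{\<omega> \<in> space M. X (\<tau> \<omega>) \<omega> = c} \<in> sets M"
  using jump_process_right_continuous[OF process] jump_process_measurable[OF process]
  by (rule measurable_exit_state)

text \<open>
  By absorption, the process is in state \<open>m + k\<close> at time \<open>t\<close> exactly if it left the transient states
  by time \<open>t\<close> and entered \<open>m + k\<close> when it did.
\<close>

lemma prob_exit_le: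
  assumes t: "0 \<le> t" and k: "k < r"
  shows "prob {\<omega> \<in> space M. \<tau> \<omega> \<le> t \<and> X (\<tau> \<omega>) \<omega> = m + k} = (\<Sum>i<m + r. \<pi> i * mexp (t \<cdot>\<^sub>m \<Lambda>) $$ (i, m + k))"
proof -
  note [measurable] = borel_measurable_\<tau> exit_state_sets[of "m + k"]
  have "AE \<omega> in M. \<omega> \<in> {\<omega> \<in> space M. \<tau> \<omega> \<le> t \<and> X (\<tau> \<omega>) \<omega> = m + k} \<longleftrightarrow>
      \<omega> \<in> {\<omega> \<in> space M. X t \<omega> = m + k}"
    using AE_space AE_absorbed
  proof eventually_elim
    case (elim \<omega>)
    have abs: "X t \<omega> = X s \<omega>" if "0 \<le> s" "s \<le> t" "m \<le> X s \<omega>" for s t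
      using elim(2) that by blast
    have "\<tau> \<omega> \<le> t \<and> X (\<tau> \<omega>) \<omega> = X t \<omega>" if "X t \<omega> = m + k"
    proof -
      have le: "\<tau> \<omega> \<le> t" using that t by (intro exit_time_le) auto
      have "X (\<tau> \<omega>) \<omega> \<notin> {..<m}"
        using jump_process_right_continuous[OF process elim(1)] t that
        by (intro exit_time_attained[of X \<omega> t]) auto
      then show ?thesis using le abs[OF exit_time_nonneg le] by auto
    qed
    moreover have "X t \<omega> = m + k" if "\<tau> \<omega> \<le> t" "X (\<tau> \<omega>) \<omega> = m + k"
      using abs[OF exit_time_nonneg that(1)] that(2) by simp
    ultimately show ?case by auto
  qed
  moreover have "{\<omega> \<in> space M. \<tau> \<omega> \<le> t \<and> X (\<tau> \<omega>) \<omega> = m + k} \<in> sets M"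
    by measurable
  ultimately have "prob {\<omega> \<in> space M. \<tau> \<omega> \<le> t \<and> X (\<tau> \<omega>) \<omega> = m + k} = prob {\<omega> \<in> space M. X t \<omega> = m + k}"
    using jump_process_sets(1)[OF process t t] by (intro measure_eq_AE) auto
  also have "\<dots> = (\<Sum>i<m + r. \<pi> i * mexp (t \<cdot>\<^sub>m \<Lambda>) $$ (i, m + k))"
    using k by (intro prob_state t) auto
  finally show ?thesis .
qed

lemma absorption_prob_has_derivative:
  assumes k: "k < r"
  shows "((\<lambda>t. \<Sum>i<m + r. \<pi> i * mexp (t \<cdot>\<^sub>m \<Lambda>) $$ (i, m + k)) has_real_derivative exit_density k t) (at t)"
proof -
  have "((\<lambda>t. \<Sum>i<m + r. \<pi> i * mexp (t \<cdot>\<^sub>m \<Lambda>) $$ (i, m + k)) has_real_derivative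
      (\<Sum>i<m + r. \<pi> i * (\<Sum>l<m. mexp (t \<cdot>\<^sub>m \<Lambda>) $$ (i, l) * U $$ (l, k)))) (at t)"
    using mexp_has_derivative_right[OF \<Lambda>_carrier, of _ "m + k" t] k
    by (intro DERIV_sum DERIV_cmult) (simp add: sum_\<Lambda>_column_absorbing)
  also have "(\<Sum>i<m + r. \<pi> i * (\<Sum>l<m. mexp (t \<cdot>\<^sub>m \<Lambda>) $$ (i, l) * U $$ (l, k))) = exit_density k t"
    unfolding exit_density_def
    by (intro sum.mono_neutral_cong_right)
      (auto simp: mexp_\<Lambda>_absorbing_row mexp_\<Lambda>_transient_block sum_distrib_left mult_ac)
  finally show ?thesis .
qed

text \<open>
  The density is the derivative of a distribution function, which is nondecreasing.
\<close>

lemma exit_density_nonneg: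
  assumes k: "k < r" and t: "0 \<le> t"
  shows "0 \<le> exit_density k t"
proof (rule ccontr)
  assume "\<not> 0 \<le> exit_density k t"
  then obtain d where d: "0 < d" "\<And>h. 0 < h \<Longrightarrow> h < d \<Longrightarrow>
      (\<Sum>i<m + r. \<pi> i * mexp ((t + h) \<cdot>\<^sub>m \<Lambda>) $$ (i, m + k)) <
      (\<Sum>i<m + r. \<pi> i * mexp (t \<cdot>\<^sub>m \<Lambda>) $$ (i, m + k))"
    using DERIV_neg_dec_right[OF absorption_prob_has_derivative[OF k, of t]] by (meson not_le)
  define h where "h = d / 2"
  have h: "0 < h" "h < d" using d(1) by (auto simp: h_def)
  note [measurable] = borel_measurable_\<tau> exit_state_sets[of "m + k"]
  have "prob {\<omega> \<in> space M. \<tau> \<omega> \<le> t \<and> X (\<tau> \<omega>) \<omega> = m + k} \<le>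
      prob {\<omega> \<in> space M. \<tau> \<omega> \<le> t + h \<and> X (\<tau> \<omega>) \<omega> = m + k}"
    using h by (intro finite_measure_mono) auto
  with d(2)[OF h] show False
    using t h k by (simp add: prob_exit_le)
qed

lemma absorption_prob_tendsto:
  assumes k: "k < r"
  shows "((\<lambda>t. \<Sum>i<m + r. \<pi> i * mexp (t \<cdot>\<^sub>m \<Lambda>) $$ (i, m + k)) \<longlongrightarrow>
    prob {\<omega> \<in> space M. X (\<tau> \<omega>) \<omega> = m + k}) at_top"
proof -
  note [measurable] = borel_measurable_\<tau> exit_state_sets[of "m + k"]
  define P where "P t = prob {\<omega> \<in> space M. \<tau> \<omega> \<le> t \<and> X (\<tau> \<omega>) \<omega> = m + k}" for t
  have "(P \<longlongrightarrow> prob {\<omega> \<in> space M. X (\<tau> \<omega>) \<omega> = m + k}) at_top"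
  proof (rule tendsto_at_topI_sequentially_real)
    show "mono P"
      unfolding P_def by (intro monoI finite_measure_mono) auto
    have "(\<lambda>n. P (real n)) \<longlonglongrightarrow> prob (\<Union>n. {\<omega> \<in> space M. \<tau> \<omega> \<le> real n \<and> X (\<tau> \<omega>) \<omega> = m + k})"
      unfolding P_def by (intro finite_Lim_measure_incseq) (auto simp: incseq_def)
    also have "(\<Union>n. {\<omega> \<in> space M. \<tau> \<omega> \<le> real n \<and> X (\<tau> \<omega>) \<omega> = m + k}) =
        {\<omega> \<in> space M. X (\<tau> \<omega>) \<omega> = m + k}"
      using real_arch_simple by auto
    finally show "(\<lambda>n. P (real n)) \<longlonglongrightarrow> prob {\<omega> \<in> space M. X (\<tau> \<omega>) \<omega> = m + k}" .
  qed
  moreover have "eventually (\<lambda>t. P t = (\<Sum>i<m + r. \<pi> i * mexp (t \<cdot>\<^sub>m \<Lambda>) $$ (i, m + k))) at_top"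
    using eventually_ge_at_top[of 0] by eventually_elim (simp add: P_def prob_exit_le k)
  ultimately show ?thesis
    by (rule Lim_transform_eventually)
qed

lemma borel_measurable_exit_density [measurable]: "exit_density k \<in> borel_measurable borel"
proof -
  have "continuous_on UNIV (\<lambda>t. mexp (t \<cdot>\<^sub>m T) $$ (i, l))" if "i < m" "l < m" for i l
    using DERIV_continuous_on[OF has_field_derivative_at_within[OF mexp_has_derivative_right[OF T that]]]
    by blast
  then have "continuous_on UNIV (exit_density k)"
    unfolding exit_density_def[abs_def] by (intro continuous_intros) auto
  then show ?thesis by (rule borel_measurable_continuous_onI)
qed

lemma prob_exit_greater:
  assumes k: "k < r" and x: "0 \<le> x"
  shows "emeasure M {\<omega> \<in> space M. x < \<tau> \<omega> \<and> X (\<tau> \<omega>) \<omega> = m + k} =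
    (\<integral>\<^sup>+t. ennreal (exit_density k t) * indicator {x<..} t \<partial>lborel)"
proof -
  note [measurable] = borel_measurable_\<tau> exit_state_sets[of "m + k"]
  define F where "F t = (\<Sum>i<m + r. \<pi> i * mexp (t \<cdot>\<^sub>m \<Lambda>) $$ (i, m + k))" for t
  define L where "L = prob {\<omega> \<in> space M. X (\<tau> \<omega>) \<omega> = m + k}"
  have "(\<integral>\<^sup>+t. ennreal (exit_density k t) * indicator {x<..} t \<partial>lborel) =
      (\<integral>\<^sup>+t. ennreal (exit_density k t) * indicator {x..} t \<partial>lborel)"
    using AE_lborel_singleton[of x]
    by (intro nn_integral_cong_AE, eventually_elim) (auto split: split_indicator)
  also have "\<dots> = ennreal (L - F x)"
    using x absorption_prob_has_derivative[OF k] exit_density_nonneg[OF k] absorption_prob_tendsto[OF k]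
    unfolding F_def[symmetric] L_def[symmetric] by (intro nn_integral_FTC_atLeast) auto
  also have "L - F x = prob ({\<omega> \<in> space M. X (\<tau> \<omega>) \<omega> = m + k} -
      {\<omega> \<in> space M. \<tau> \<omega> \<le> x \<and> X (\<tau> \<omega>) \<omega> = m + k})"
    unfolding L_def F_def prob_exit_le[OF x k, symmetric]
    by (rule finite_measure_Diff[symmetric]) auto
  also have "{\<omega> \<in> space M. X (\<tau> \<omega>) \<omega> = m + k} - {\<omega> \<in> space M. \<tau> \<omega> \<le> x \<and> X (\<tau> \<omega>) \<omega> = m + k} =
      {\<omega> \<in> space M. x < \<tau> \<omega> \<and> X (\<tau> \<omega>) \<omega> = m + k}"
    by auto
  finally show ?thesis by (simp add: emeasure_eq_measure)
qed

text \<open>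
  On \<open>(y, \<infinity>)\<close> the law of \<open>\<tau>\<close> on the event \<open>{X\<^sub>\<tau> = m + k}\<close> and the measure with density \<open>exit_density k\<close>
  agree on all half-lines \<open>(x, \<infinity>)\<close>, hence are equal.
\<close>

lemma nn_integral_exit:
  assumes k: "k < r" and y: "0 \<le> y" and g [measurable]: "g \<in> borel_measurable borel"
  shows "(\<integral>\<^sup>+\<omega>. g (\<tau> \<omega>) * indicator {\<omega> \<in> space M. y < \<tau> \<omega> \<and> X (\<tau> \<omega>) \<omega> = m + k} \<omega> \<partial>M) =
    (\<integral>\<^sup>+t. g t * (ennreal (exit_density k t) * indicator {y<..} t) \<partial>lborel)"
proof -
  note [measurable] = borel_measurable_\<tau> exit_state_sets[of "m + k"]
  define A where "A = {\<omega> \<in> space M. y < \<tau> \<omega> \<and> X (\<tau> \<omega>) \<omega> = m + k}"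
  have [measurable]: "A \<in> sets M" unfolding A_def by measurable
  define N1 where "N1 = distr (density M (indicator A)) borel \<tau>"
  define N2 where "N2 = density lborel (\<lambda>t. ennreal (exit_density k t) * indicator {y<..} t)"
  have N1: "emeasure N1 {x<..} = emeasure M {\<omega> \<in> space M. max x y < \<tau> \<omega> \<and> X (\<tau> \<omega>) \<omega> = m + k}" for x
  proof -
    have "emeasure N1 {x<..} = emeasure (density M (indicator A)) (\<tau> -` {x<..} \<inter> space M)"
      unfolding N1_def by (subst emeasure_distr) auto
    also have "\<dots> = (\<integral>\<^sup>+\<omega>. indicator A \<omega> * indicator (\<tau> -` {x<..} \<inter> space M) \<omega> \<partial>M)"
      by (intro emeasure_density) measurable
    also have "\<dots> = (\<integral>\<^sup>+\<omega>. indicator {\<omega> \<in> space M. max x y < \<tau> \<omega> \<and> X (\<tau> \<omega>) \<omega> = m + k} \<omega> \<partial>M)"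
      by (intro nn_integral_cong) (auto simp: A_def split: split_indicator)
    also have "\<dots> = emeasure M {\<omega> \<in> space M. max x y < \<tau> \<omega> \<and> X (\<tau> \<omega>) \<omega> = m + k}"
      by (intro nn_integral_indicator) measurable
    finally show ?thesis .
  qed
  have "N1 = N2"
  proof (rule measure_eqI_lessThan)
    show "sets N1 = sets borel" "sets N2 = sets borel" by (simp_all add: N1_def N2_def)
    show "emeasure N1 {x<..} < \<infinity>" for x
      unfolding N1 by (simp add: emeasure_eq_measure)
    show "emeasure N1 {x<..} = emeasure N2 {x<..}" for x
    proof -
      have "emeasure N2 {x<..} = (\<integral>\<^sup>+t. (ennreal (exit_density k t) * indicator {y<..} t) * indicator {x<..} t \<partial>lborel)"
        unfolding N2_def by (intro emeasure_density) auto
      also have "\<dots> = (\<integral>\<^sup>+t. ennreal (exit_density k t) * indicator {max x y<..} t \<partial>lborel)"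
        by (intro nn_integral_cong) (auto split: split_indicator)
      finally have N2: "emeasure N2 {x<..} = \<dots>" .
      show ?thesis
        unfolding N1 N2 using y by (intro prob_exit_greater k) auto
    qed
  qed
  have "(\<integral>\<^sup>+\<omega>. g (\<tau> \<omega>) * indicator A \<omega> \<partial>M) = (\<integral>\<^sup>+t. g t \<partial>N1)"
    unfolding N1_def by (subst nn_integral_distr) (auto simp: nn_integral_density mult.commute)
  also have "\<dots> = (\<integral>\<^sup>+t. g t * (ennreal (exit_density k t) * indicator {y<..} t) \<partial>lborel)"
    unfolding \<open>N1 = N2\<close> N2_def by (subst nn_integral_density) (auto simp: mult.commute)
  finally show ?thesis by (simp add: A_def)
qed

text \<open>
  The closed form of \<open>E(\<tau>\<^bsup>N\<^esup> e\<^bsup>-\<theta>\<tau>\<^esup>; \<tau> > y, X\<^sub>\<tau> = m + k)\<close>, valid when the integral of the augmented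
  exponential over \<open>[y, \<infinity>)\<close> converges.
\<close>

definition exit_moment :: "nat \<Rightarrow> real \<Rightarrow> nat \<Rightarrow> real \<Rightarrow> real" where
  "exit_moment N \<theta> k y = fact N * (\<Sum>i<m. \<Sum>l<m. \<pi> i *
     (mexp (y \<cdot>\<^sub>m aug_mat N \<theta> T) * minv (- aug_mat N \<theta> T)) $$ (i, N * m + l) * U $$ (l, k))"

text \<open>
  The weighted density \<open>t\<^bsup>N\<^esup> e\<^bsup>-\<theta>t\<^esup> exit_density k t\<close> is a combination of entries of the exponential of the
  augmented matrix, so \<open>- exit_moment N \<theta> k\<close> is an antiderivative that vanishes at infinity, and the
  fundamental theorem of calculus evaluates the integral.
\<close>

lemma nn_integral_exit_moment:
  assumes k: "k < r" and y: "0 \<le> y"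
    and conv: "exp_integral_converges (aug_mat N \<theta> T) y"
    and inv: "invertible_mat (aug_mat N \<theta> T)"
  shows "(\<integral>\<^sup>+\<omega>. ennreal (\<tau> \<omega> ^ N * exp (- \<theta> * \<tau> \<omega>)) *
      indicator {\<omega> \<in> space M. y < \<tau> \<omega> \<and> X (\<tau> \<omega>) \<omega> = m + k} \<omega> \<partial>M) = ennreal (exit_moment N \<theta> k y)"
    and "0 \<le> exit_moment N \<theta> k y"
proof -
  let ?A = "aug_mat N \<theta> T"
  have A: "?A \<in> carrier_mat ((N + 1) * m) ((N + 1) * m)"
    by (rule aug_mat_carrier[OF T])
  have idx: "i < (N + 1) * m" "N * m + l < (N + 1) * m" if "i < m" "l < m" for i l
    using that block_index_less[of N N l m] by auto
  have deriv: "((\<lambda>t. - exit_moment N \<theta> k t) has_real_derivative t ^ N * exp (- \<theta> * t) * exit_density k t) (at t)" for t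
  proof -
    have "((\<lambda>t. - exit_moment N \<theta> k t) has_real_derivative
        - (fact N * (\<Sum>i<m. \<Sum>l<m. \<pi> i * (- (mexp (t \<cdot>\<^sub>m ?A) $$ (i, N * m + l))) * U $$ (l, k)))) (at t)"
      unfolding exit_moment_def
      by (intro DERIV_minus DERIV_cmult DERIV_sum DERIV_cmult_right mexp_antiderivative[OF A inv] idx) auto
    also have "- (fact N * (\<Sum>i<m. \<Sum>l<m. \<pi> i * (- (mexp (t \<cdot>\<^sub>m ?A) $$ (i, N * m + l))) * U $$ (l, k))) =
        t ^ N * exp (- \<theta> * t) * exit_density k t"
      unfolding exit_density_def using mexp_aug_mat_first_row[OF T _ _ order_refl]
      by (simp add: sum_negf sum_distrib_left mult_ac)
    finally show ?thesis .
  qed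
  have nonneg: "0 \<le> t ^ N * exp (- \<theta> * t) * exit_density k t" if "y \<le> t" for t
    using y that exit_density_nonneg[OF k, of t] by simp
  have "((\<lambda>t. - exit_moment N \<theta> k t) \<longlongrightarrow>
      - (fact N * (\<Sum>i<m. \<Sum>l<m. \<pi> i * 0 * U $$ (l, k)))) at_top"
    unfolding exit_moment_def
    by (intro tendsto_intros mexp_antiderivative_tendsto_0[OF A inv conv] idx) auto
  then have lim: "((\<lambda>t. - exit_moment N \<theta> k t) \<longlongrightarrow> 0) at_top" by simp
  have "(\<integral>\<^sup>+\<omega>. ennreal (\<tau> \<omega> ^ N * exp (- \<theta> * \<tau> \<omega>)) *
      indicator {\<omega> \<in> space M. y < \<tau> \<omega> \<and> X (\<tau> \<omega>) \<omega> = m + k} \<omega> \<partial>M) =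
      (\<integral>\<^sup>+t. ennreal (t ^ N * exp (- \<theta> * t)) * (ennreal (exit_density k t) * indicator {y<..} t) \<partial>lborel)"
    by (rule nn_integral_exit[OF k y]) measurable
  also have "\<dots> = (\<integral>\<^sup>+t. ennreal (t ^ N * exp (- \<theta> * t) * exit_density k t) * indicator {y..} t \<partial>lborel)"
    using AE_lborel_singleton[of y]
  proof (intro nn_integral_cong_AE, eventually_elim)
    case (elim t)
    then show ?case
      using y exit_density_nonneg[OF k, of t] by (auto simp: ennreal_mult' split: split_indicator)
  qed
  also have "\<dots> = ennreal (0 - - exit_moment N \<theta> k y)"
    by (rule nn_integral_FTC_atLeast[OF _ deriv nonneg lim]) auto
  finally show "(\<integral>\<^sup>+\<omega>. ennreal (\<tau> \<omega> ^ N * exp (- \<theta> * \<tau> \<omega>)) *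
      indicator {\<omega> \<in> space M. y < \<tau> \<omega> \<and> X (\<tau> \<omega>) \<omega> = m + k} \<omega> \<partial>M) = ennreal (exit_moment N \<theta> k y)"
    by simp
  have "- exit_moment N \<theta> k y \<le> - exit_moment N \<theta> k t" if "y \<le> t" for t
    using deriv nonneg by (intro DERIV_nonneg_imp_nondecreasing[OF that]) blast
  then have "- exit_moment N \<theta> k y \<le> 0"
    by (intro tendsto_lowerbound[OF lim] eventually_mono[OF eventually_ge_at_top[of y]]) auto
  then show "0 \<le> exit_moment N \<theta> k y" by simp
qed

end

section \<open>Entries of products with the block vectors and matrices\<close>

lemma shock_matrix_index:
  assumes U: "U \<in> carrier_mat m p" and i: "i < m" and c: "c < p" and d: "d < p"
  shows "shock_matrix U $$ (i, c * p + d) = (if c = d then U $$ (i, c) else 0)"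
proof -
  have j: "c * p + d < p * p"
    using block_index_less[of c "p - 1" d p] c d by simp
  have entry: "((U * unit_col p k) * kron (transpose_mat (unit_col p k)) (transpose_mat (unit_col p k))) $$ (i, c * p + d)
      = (if c = k \<and> d = k then U $$ (i, k) else 0)" if k: "k < p" for k
  proof -
    let ?K = "kron (transpose_mat (unit_col p k)) (transpose_mat (unit_col p k))"
    have u: "unit_col p k \<in> carrier_mat p 1" by (simp add: unit_col_def)
    have K: "?K \<in> carrier_mat 1 (p * p)" by (auto simp: kron_def unit_col_def)
    have "(U * unit_col p k) $$ (i, 0) = (\<Sum>l<p. U $$ (i, l) * unit_col p k $$ (l, 0))"
      by (rule index_mult_mat_sum[OF U u i]) simp
    also have "\<dots> = (\<Sum>l<p. if l = k then U $$ (i, k) else 0)"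
      by (intro sum.cong) (auto simp: unit_col_def)
    finally have "(U * unit_col p k) $$ (i, 0) = U $$ (i, k)"
      using k by simp
    moreover have "?K $$ (0, c * p + d) = (if c = k \<and> d = k then 1 else 0)"
      using j c d by (auto simp: kron_def unit_col_def)
    ultimately show ?thesis
      using index_mult_mat_sum[OF mult_carrier_mat[OF U u] K i j] by simp
  qed
  have "shock_matrix U $$ (i, c * p + d) = (\<Sum>k<p. if c = k \<and> d = k then U $$ (i, k) else 0)"
    using U i j by (simp add: shock_matrix_def Let_def entry del: index_mult_mat)
  also have "\<dots> = (\<Sum>k<p. if k = c then if c = d then U $$ (i, c) else 0 else 0)"
    by (intro sum.cong) auto
  finally show ?thesis using c by simp
qed

text \<open>
  The shock matrix copies the state \<open>k\<close> into the pair \<open>(k, k)\<close>, the index at which the Kronecker product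
  holds \<open>v\<^sub>k w\<^sub>k\<close>.
\<close>

lemma shock_matrix_kron_index:
  assumes U: "U \<in> carrier_mat m p" and i: "i < m"
    and v: "v \<in> carrier_mat p 1" and w: "w \<in> carrier_mat p 1"
  shows "(shock_matrix U * kron v w) $$ (i, 0) = (\<Sum>k<p. U $$ (i, k) * v $$ (k, 0) * w $$ (k, 0))"
proof -
  have S: "shock_matrix U \<in> carrier_mat m (p * p)"
    using U by (simp add: shock_matrix_def Let_def)
  have K: "kron v w \<in> carrier_mat (p * p) 1"
    using v w by (simp add: kron_def)
  have "(shock_matrix U * kron v w) $$ (i, 0) = (\<Sum>c<p. \<Sum>d<p. shock_matrix U $$ (i, c * p + d) * kron v w $$ (c * p + d, 0))"
    unfolding index_mult_mat_sum[OF S K i zero_less_one_nat] sum_blocks ..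
  also have "\<dots> = (\<Sum>c<p. \<Sum>d<p. if d = c then U $$ (i, c) * v $$ (c, 0) * w $$ (c, 0) else 0)"
  proof (intro sum.cong refl)
    fix c d assume cd: "c \<in> {..<p}" "d \<in> {..<p}"
    then have "c * p + d < p * p"
      using block_index_less[of c "p - 1" d p] by simp
    then have "kron v w $$ (c * p + d, 0) = v $$ (c, 0) * w $$ (d, 0)"
      using v w cd by (simp add: kron_def)
    then show "shock_matrix U $$ (i, c * p + d) * kron v w $$ (c * p + d, 0) =
        (if d = c then U $$ (i, c) * v $$ (c, 0) * w $$ (c, 0) else 0)"
      using cd by (simp add: shock_matrix_index[OF U i])
  qed
  also have "\<dots> = (\<Sum>k<p. U $$ (i, k) * v $$ (k, 0) * w $$ (k, 0))"
    by (intro sum.cong refl) simp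
  finally show ?thesis .
qed

lemma aug_row_mult_index:
  assumes \<alpha>: "\<alpha> \<in> carrier_mat 1 m" and B: "B \<in> carrier_mat ((N + 1) * m) c" and j: "j < c"
  shows "(aug_row N \<alpha> * B) $$ (0, j) = (\<Sum>i<m. \<alpha> $$ (0, i) * B $$ (i, j))"
proof -
  have a: "aug_row N \<alpha> \<in> carrier_mat 1 ((N + 1) * m)"
    using \<alpha> by (simp add: aug_row_def)
  have "(aug_row N \<alpha> * B) $$ (0, j) = (\<Sum>q<(N + 1) * m. aug_row N \<alpha> $$ (0, q) * B $$ (q, j))"
    by (rule index_mult_mat_sum[OF a B zero_less_one_nat j])
  also have "\<dots> = (\<Sum>i<m. \<alpha> $$ (0, i) * B $$ (i, j))"
    using \<alpha> by (intro sum.mono_neutral_cong_right) (auto simp: aug_row_def)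
  finally show ?thesis .
qed

lemma sum_last_block:
  fixes f :: "nat \<Rightarrow> 'a :: comm_monoid_add"
  assumes "\<And>q. q < (N + 1) * p \<Longrightarrow> q div p \<noteq> N \<Longrightarrow> f q = 0"
  shows "(\<Sum>q<(N + 1) * p. f q) = (\<Sum>l<p. f (N * p + l))"
proof -
  have "(\<Sum>l<p. f (c * p + l)) = 0" if "c < N" for c
    using that by (intro sum.neutral ballI assms block_index_less) auto
  then show ?thesis
    unfolding sum_blocks by simp
qed

lemma mult_id_down_index:
  assumes A: "A \<in> carrier_mat a ((N + 1) * p)" and i: "i < a" and l: "l < p"
  shows "(A * id_down N p) $$ (i, l) = A $$ (i, N * p + l)"
proof -
  have D: "id_down N p \<in> carrier_mat ((N + 1) * p) p"
    by (simp add: id_down_def)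
  have "(A * id_down N p) $$ (i, l) = (\<Sum>q<(N + 1) * p. A $$ (i, q) * id_down N p $$ (q, l))"
    by (rule index_mult_mat_sum[OF A D i l])
  also have "\<dots> = (\<Sum>k<p. A $$ (i, N * p + k) * id_down N p $$ (N * p + k, l))"
    using l by (intro sum_last_block) (auto simp: id_down_def)
  also have "\<dots> = (\<Sum>k<p. if k = l then A $$ (i, N * p + l) else 0)"
    using l block_index_less[of N N _ p] by (intro sum.cong refl) (auto simp: id_down_def)
  finally show ?thesis using l by simp
qed

lemma mult_aug_col_index:
  assumes A: "A \<in> carrier_mat a ((N + 1) * p)" and i: "i < a" and q: "q \<in> carrier_mat p 1"
  shows "(A * aug_col N q) $$ (i, 0) = (\<Sum>l<p. A $$ (i, N * p + l) * q $$ (l, 0))"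
proof -
  have C: "aug_col N q \<in> carrier_mat ((N + 1) * p) 1"
    using q by (simp add: aug_col_def Let_def)
  have "(A * aug_col N q) $$ (i, 0) = (\<Sum>j<(N + 1) * p. A $$ (i, j) * aug_col N q $$ (j, 0))"
    by (rule index_mult_mat_sum[OF A C i zero_less_one_nat])
  also have "\<dots> = (\<Sum>l<p. A $$ (i, N * p + l) * aug_col N q $$ (N * p + l, 0))"
    using q by (intro sum_last_block) (auto simp: aug_col_def Let_def)
  also have "\<dots> = (\<Sum>l<p. A $$ (i, N * p + l) * q $$ (l, 0))"
    using q block_index_less[of N N _ p] by (intro sum.cong refl) (auto simp: aug_col_def Let_def)
  finally show ?thesis .
qed

lemma id_left_mult_index:
  assumes B: "B \<in> carrier_mat ((N + 1) * p) c" and i: "i < p" and j: "j < c"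
  shows "(id_left N p * B) $$ (i, j) = B $$ (i, j)"
proof -
  have D: "id_left N p \<in> carrier_mat p ((N + 1) * p)"
    by (simp add: id_left_def)
  have "(id_left N p * B) $$ (i, j) = (\<Sum>q<(N + 1) * p. id_left N p $$ (i, q) * B $$ (q, j))"
    by (rule index_mult_mat_sum[OF D B i j])
  also have "\<dots> = (\<Sum>q<(N + 1) * p. if q = i then B $$ (i, j) else 0)"
    using i by (intro sum.cong refl) (auto simp: id_left_def div_eq_0_iff)
  finally show ?thesis using i by simp
qed

text \<open>
  The block vectors select the first block row and the last block column of \<open>E I\<close>, and the shock matrix
  joins the two Kronecker factors in a common state \<open>k\<close>, the state entered at the shock.
\<close>

lemma master_product_entry:
  assumes \<alpha>: "\<alpha> \<in> carrier_mat 1 m" and E: "E \<in> carrier_mat ((N + 1) * m) ((N + 1) * m)"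
    and I: "I \<in> carrier_mat ((N + 1) * m) ((N + 1) * m)" and U: "U \<in> carrier_mat m p"
    and v: "v \<in> carrier_mat p 1" and w: "w \<in> carrier_mat p 1"
  shows "(aug_row N \<alpha> * E * I * id_down N m * shock_matrix U * kron v w) $$ (0, 0) =
    (\<Sum>k<p. (\<Sum>i<m. \<Sum>l<m. \<alpha> $$ (0, i) * (E * I) $$ (i, N * m + l) * U $$ (l, k)) * v $$ (k, 0) * w $$ (k, 0))"
proof -
  let ?n = "(N + 1) * m"
  define B where "B = E * I"
  have B: "B \<in> carrier_mat ?n ?n" unfolding B_def by (rule mult_carrier_mat[OF E I])
  have a: "aug_row N \<alpha> \<in> carrier_mat 1 ?n" using \<alpha> by (simp add: aug_row_def)
  have aB: "aug_row N \<alpha> * B \<in> carrier_mat 1 ?n" by (rule mult_carrier_mat[OF a B])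
  have down: "id_down N m \<in> carrier_mat ?n m" by (simp add: id_down_def)
  have aBd: "aug_row N \<alpha> * B * id_down N m \<in> carrier_mat 1 m"
    by (rule mult_carrier_mat[OF aB down])
  have S: "shock_matrix U \<in> carrier_mat m (p * p)"
    using U by (simp add: shock_matrix_def Let_def)
  have K: "kron v w \<in> carrier_mat (p * p) 1"
    using v w by (simp add: kron_def)
  define b where "b i l = \<alpha> $$ (0, i) * B $$ (i, N * m + l)" for i l
  have "aug_row N \<alpha> * E * I * id_down N m * shock_matrix U * kron v w =
      (aug_row N \<alpha> * B * id_down N m) * (shock_matrix U * kron v w)"
    unfolding B_def assoc_mult_mat[OF a E I] by (rule assoc_mult_mat[OF aBd[unfolded B_def] S K])
  also have "\<dots> $$ (0, 0) = (\<Sum>l<m. (aug_row N \<alpha> * B * id_down N m) $$ (0, l) *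
      (shock_matrix U * kron v w) $$ (l, 0))"
    by (rule index_mult_mat_sum[OF aBd mult_carrier_mat[OF S K] zero_less_one_nat zero_less_one_nat])
  also have "\<dots> = (\<Sum>l<m. (\<Sum>i<m. b i l) * (\<Sum>k<p. U $$ (l, k) * v $$ (k, 0) * w $$ (k, 0)))"
  proof (intro sum.cong refl)
    fix l assume l: "l \<in> {..<m}"
    then have idx: "N * m + l < ?n" using block_index_less[of N N l m] by simp
    show "(aug_row N \<alpha> * B * id_down N m) $$ (0, l) * (shock_matrix U * kron v w) $$ (l, 0) =
        (\<Sum>i<m. b i l) * (\<Sum>k<p. U $$ (l, k) * v $$ (k, 0) * w $$ (k, 0))"
      using l by (simp only: b_def mult_id_down_index[OF aB zero_less_one_nat] aug_row_mult_index[OF \<alpha> B idx]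
        shock_matrix_kron_index[OF U _ v w] lessThan_iff)
  qed
  also have "\<dots> = (\<Sum>k<p. \<Sum>l<m. (\<Sum>i<m. b i l) * (U $$ (l, k) * v $$ (k, 0) * w $$ (k, 0)))"
    unfolding sum_distrib_left by (rule sum.swap)
  also have "\<dots> = (\<Sum>k<p. (\<Sum>i<m. \<Sum>l<m. b i l * U $$ (l, k)) * v $$ (k, 0) * w $$ (k, 0))"
  proof (intro sum.cong refl)
    fix k
    have "(\<Sum>l<m. (\<Sum>i<m. b i l) * (U $$ (l, k) * v $$ (k, 0) * w $$ (k, 0))) =
        (\<Sum>l<m. \<Sum>i<m. b i l * U $$ (l, k)) * v $$ (k, 0) * w $$ (k, 0)"
      by (simp add: sum_distrib_right mult.assoc)
    also have "(\<Sum>l<m. \<Sum>i<m. b i l * U $$ (l, k)) = (\<Sum>i<m. \<Sum>l<m. b i l * U $$ (l, k))"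
      by (rule sum.swap)
    finally show "(\<Sum>l<m. (\<Sum>i<m. b i l) * (U $$ (l, k) * v $$ (k, 0) * w $$ (k, 0))) =
        (\<Sum>i<m. \<Sum>l<m. b i l * U $$ (l, k)) * v $$ (k, 0) * w $$ (k, 0)" .
  qed
  finally show ?thesis unfolding b_def B_def .
qed

section \<open>Residual lifetimes\<close>

lemma residual_intensity_eq_shock_intensity:
  "residual_intensity p Q = shock_intensity p 1 Q (exit_rates Q)"
  by (simp add: residual_intensity_def shock_intensity_def)

lemma exit_rates_carrier: "Q \<in> carrier_mat p p \<Longrightarrow> exit_rates Q \<in> carrier_mat p 1"
  by (simp add: exit_rates_def ones_def)

lemma residual_exit_moment:
  assumes Q: "Q \<in> carrier_mat p p" and k: "k < p"
    and Y: "absorbed_jump_process M p 1 (\<lambda>i. if i = k then 1 else 0) Q (exit_rates Q) Y"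
    and inv: "invertible_mat (aug_mat N \<theta> Q)"
  shows "absorbed_jump_process.exit_moment p (\<lambda>i. if i = k then 1 else 0) Q (exit_rates Q) N \<theta> 0 y =
    fact N * (id_left N p * mexp (y \<cdot>\<^sub>m aug_mat N \<theta> Q) * minv (- aug_mat N \<theta> Q) * aug_col N (exit_rates Q)) $$ (k, 0)"
proof -
  let ?E = "mexp (y \<cdot>\<^sub>m aug_mat N \<theta> Q)" and ?B = "minv (- aug_mat N \<theta> Q)"
  let ?n = "(N + 1) * p"
  have A: "aug_mat N \<theta> Q \<in> carrier_mat ?n ?n" by (rule aug_mat_carrier[OF Q])
  have E: "?E \<in> carrier_mat ?n ?n" and B: "?B \<in> carrier_mat ?n ?n"
    using A minv_uminus(1)[OF A inv] by auto
  have D: "id_left N p \<in> carrier_mat p ?n" by (simp add: id_left_def)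
  have "(id_left N p * ?E * ?B * aug_col N (exit_rates Q)) $$ (k, 0) =
      (\<Sum>l<p. (id_left N p * ?E * ?B) $$ (k, N * p + l) * exit_rates Q $$ (l, 0))"
    by (rule mult_aug_col_index[OF mult_carrier_mat[OF mult_carrier_mat[OF D E] B] k exit_rates_carrier[OF Q]])
  also have "\<dots> = (\<Sum>l<p. (?E * ?B) $$ (k, N * p + l) * exit_rates Q $$ (l, 0))"
  proof (intro sum.cong refl)
    fix l assume "l \<in> {..<p}"
    then have idx: "N * p + l < ?n" using block_index_less[of N N l p] by simp
    show "(id_left N p * ?E * ?B) $$ (k, N * p + l) * exit_rates Q $$ (l, 0) =
        (?E * ?B) $$ (k, N * p + l) * exit_rates Q $$ (l, 0)"
      unfolding assoc_mult_mat[OF D E B] 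
        id_left_mult_index[OF mult_carrier_mat[OF E B] k idx] ..
  qed
  finally have R: "(id_left N p * ?E * ?B * aug_col N (exit_rates Q)) $$ (k, 0) = \<dots>" .
  have "(\<Sum>i<p. \<Sum>l<p. (if i = k then 1 else 0) * (?E * ?B) $$ (i, N * p + l) * exit_rates Q $$ (l, 0)) =
      (\<Sum>i<p. if i = k then \<Sum>l<p. (?E * ?B) $$ (k, N * p + l) * exit_rates Q $$ (l, 0) else 0)"
    by (intro sum.cong refl) auto
  then show ?thesis
    unfolding absorbed_jump_process.exit_moment_def[OF Y] R using k by simp
qed

text \<open>
  The contribution of one time to the integrand. The indicator is kept inside the weight so that the
  integrand of the master formula is a product of functions of the three single times.
\<close>

definition tail_weight :: "nat \<Rightarrow> real \<Rightarrow> real \<Rightarrow> real \<Rightarrow> ennreal" where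
  "tail_weight n \<theta> a t = ennreal (t ^ n * exp (- \<theta> * t)) * indicator {a<..} t"

lemma borel_measurable_tail_weight [measurable]: "tail_weight n \<theta> a \<in> borel_measurable borel"
  unfolding tail_weight_def by measurable

text \<open>
  The conditional factor of one residual lifetime given the state \<open>k\<close> entered at the shock: the case of
  a single absorbing state, entered with the exit rates, and of the start in \<open>k\<close>.
\<close>

lemma nn_integral_residual_lifetime:
  fixes M :: "'w measure" and k p :: nat
  defines "\<delta> \<equiv> (\<lambda>i. if i = k then 1 else 0 :: real)"
  assumes M: "prob_space M" and Q: "Q \<in> carrier_mat p p" and k: "k < p"
    and Y: "markov_jump_process M (p + 1) \<delta> (residual_intensity p Q) Y"
    and a: "0 \<le> a" and conv: "exp_integral_converges (aug_mat N \<theta> Q) a"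
    and inv: "invertible_mat (aug_mat N \<theta> Q)"
  shows "(\<integral>\<^sup>+\<omega>. tail_weight N \<theta> a (residual_lifetime p Y \<omega>) \<partial>M) =
      ennreal (fact N * (id_left N p * mexp (a \<cdot>\<^sub>m aug_mat N \<theta> Q) * minv (- aug_mat N \<theta> Q)
        * aug_col N (exit_rates Q)) $$ (k, 0))"
    and "0 \<le> fact N * (id_left N p * mexp (a \<cdot>\<^sub>m aug_mat N \<theta> Q) * minv (- aug_mat N \<theta> Q)
        * aug_col N (exit_rates Q)) $$ (k, 0)"
proof -
  have absorbed: "absorbed_jump_process M p 1 \<delta> Q (exit_rates Q) Y"
    using M Q exit_rates_carrier[OF Q] Y
    unfolding absorbed_jump_process_def absorbed_jump_process_axioms_def residual_intensity_eq_shock_intensity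
    by blast
  interpret Y: absorbed_jump_process M p 1 \<delta> Q "exit_rates Q" Y by (rule absorbed)
  have R_eq: "residual_lifetime p Y = Y.\<tau>"
    by (simp add: fun_eq_iff residual_lifetime_def)
  \<comment> \<open>A positive lifetime ends in the only absorbing state, so the exit state carries no
    information here.\<close>
  have "tail_weight N \<theta> a (Y.\<tau> \<omega>) = ennreal (Y.\<tau> \<omega> ^ N * exp (- \<theta> * Y.\<tau> \<omega>)) *
      indicator {\<omega> \<in> space M. a < Y.\<tau> \<omega> \<and> Y (Y.\<tau> \<omega>) \<omega> = p + 0} \<omega>" if \<omega>: "\<omega> \<in> space M" for \<omega>
  proof -
    have "Y (Y.\<tau> \<omega>) \<omega> = p" if "a < Y.\<tau> \<omega>"
    proof -
      have "Y (Y.\<tau> \<omega>) \<omega> \<notin> {..<p}"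
        using jump_process_right_continuous[OF Y.process \<omega>] a that
        by (intro exit_time_pos_left[of Y \<omega>]) auto
      moreover have "Y (Y.\<tau> \<omega>) \<omega> < p + 1"
        by (rule jump_process_less[OF Y.process exit_time_nonneg \<omega>])
      ultimately show ?thesis by simp
    qed
    then show ?thesis
      using \<omega> by (auto simp: tail_weight_def split: split_indicator)
  qed
  then have "(\<integral>\<^sup>+\<omega>. tail_weight N \<theta> a (Y.\<tau> \<omega>) \<partial>M) =
      (\<integral>\<^sup>+\<omega>. ennreal (Y.\<tau> \<omega> ^ N * exp (- \<theta> * Y.\<tau> \<omega>)) *
        indicator {\<omega> \<in> space M. a < Y.\<tau> \<omega> \<and> Y (Y.\<tau> \<omega>) \<omega> = p + 0} \<omega> \<partial>M)"
    by (rule nn_integral_cong)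
  also have "\<dots> = ennreal (Y.exit_moment N \<theta> 0 a)"
    by (rule Y.nn_integral_exit_moment(1)[OF zero_less_one_nat a conv inv])
  finally show "(\<integral>\<^sup>+\<omega>. tail_weight N \<theta> a (residual_lifetime p Y \<omega>) \<partial>M) =
      ennreal (fact N * (id_left N p * mexp (a \<cdot>\<^sub>m aug_mat N \<theta> Q) * minv (- aug_mat N \<theta> Q)
        * aug_col N (exit_rates Q)) $$ (k, 0))"
    unfolding R_eq residual_exit_moment[OF Q k absorbed[unfolded \<delta>_def] inv, folded \<delta>_def] .
  show "0 \<le> fact N * (id_left N p * mexp (a \<cdot>\<^sub>m aug_mat N \<theta> Q) * minv (- aug_mat N \<theta> Q)
        * aug_col N (exit_rates Q)) $$ (k, 0)"
    using Y.nn_integral_exit_moment(2)[OF zero_less_one_nat a conv inv]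
    unfolding residual_exit_moment[OF Q k absorbed[unfolded \<delta>_def] inv, folded \<delta>_def] .
qed

section \<open>The master formula\<close>

lemma (in prob_space) nn_integral_indep3:
  assumes indep: "indep_sets (\<lambda>i. [F0, F1, F2] ! i) {..<3}"
    and meas: "f0 \<in> borel_measurable M" "f1 \<in> borel_measurable M" "f2 \<in> borel_measurable M"
    and F: "\<And>B. B \<in> sets borel \<Longrightarrow> f0 -` B \<inter> space M \<in> F0"
      "\<And>B. B \<in> sets borel \<Longrightarrow> f1 -` B \<inter> space M \<in> F1"
      "\<And>B. B \<in> sets borel \<Longrightarrow> f2 -` B \<inter> space M \<in> F2"
  shows "(\<integral>\<^sup>+\<omega>. f0 \<omega> * f1 \<omega> * f2 \<omega> \<partial>M) =
    (\<integral>\<^sup>+\<omega>. f0 \<omega> \<partial>M) * (\<integral>\<^sup>+\<omega>. f1 \<omega> \<partial>M) * (\<integral>\<^sup>+\<omega>. (f2 \<omega> :: ennreal) \<partial>M)"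
proof -
  have lt3: "{..<3 :: nat} = {0, 1, 2}" by auto
  have "indep_vars (\<lambda>_. borel) (\<lambda>i. [f0, f1, f2] ! i) {..<3}"
    unfolding indep_vars_def2
  proof
    show "\<forall>i\<in>{..<3}. random_variable borel ([f0, f1, f2] ! i)"
      using meas by (auto simp: lt3)
    show "indep_sets (\<lambda>i. {([f0, f1, f2] ! i) -` A \<inter> space M | A. A \<in> sets borel}) {..<3}"
      using F by (intro indep_sets_mono_sets[OF indep]) (auto simp: lt3)
  qed
  from indep_vars_nn_integral[OF _ this] show ?thesis
    by (simp add: lt3 mult.assoc)
qed

theorem theorem5p4:
  fixes M :: "'w measure"
    and m p :: nat
    and \<alpha> T U Q1 Q2 :: "real mat"
    and Z Y1 Y2 :: "real \<Rightarrow> 'w \<Rightarrow> nat"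
    and n12 n1 n2 :: nat
    and \<theta>12 \<theta>1 \<theta>2 y12 y1 y2 :: real
  assumes model: "common_shock_model M m p \<alpha> T U Q1 Q2 Z Y1 Y2"
    and y: "0 \<le> y12" "0 \<le> y1" "0 \<le> y2"
    and conv: "exp_integral_converges (aug_mat n12 \<theta>12 T) y12"
              "exp_integral_converges (aug_mat n1 \<theta>1 Q1) y1"
              "exp_integral_converges (aug_mat n2 \<theta>2 Q2) y2"
    and inv: "invertible_mat (aug_mat n12 \<theta>12 T)"
             "invertible_mat (aug_mat n1 \<theta>1 Q1)"
             "invertible_mat (aug_mat n2 \<theta>2 Q2)"
  shows "has_bochner_integral M
    (\<lambda>\<omega>. (shock_time m Z \<omega> ^ n12 * exp (- \<theta>12 * shock_time m Z \<omega>))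
        * (residual_lifetime p Y1 \<omega> ^ n1 * exp (- \<theta>1 * residual_lifetime p Y1 \<omega>))
        * (residual_lifetime p Y2 \<omega> ^ n2 * exp (- \<theta>2 * residual_lifetime p Y2 \<omega>))
        * indicator {\<omega> \<in> space M. shock_time m Z \<omega> > y12 \<and>
            residual_lifetime p Y1 \<omega> > y1 \<and> residual_lifetime p Y2 \<omega> > y2} \<omega>)
    ((fact n12 * fact n1 * fact n2) *
      (aug_row n12 \<alpha> * mexp (y12 \<cdot>\<^sub>m aug_mat n12 \<theta>12 T) * minv (- aug_mat n12 \<theta>12 T)
        * id_down n12 m * shock_matrix U
        * kron
          (id_left n1 p * mexp (y1 \<cdot>\<^sub>m aug_mat n1 \<theta>1 Q1) * minv (- aug_mat n1 \<theta>1 Q1)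
            * aug_col n1 (exit_rates Q1))
          (id_left n2 p * mexp (y2 \<cdot>\<^sub>m aug_mat n2 \<theta>2 Q2) * minv (- aug_mat n2 \<theta>2 Q2)
            * aug_col n2 (exit_rates Q2))) $$ (0, 0))"
proof -
  define \<pi> where "\<pi> = (\<lambda>i. if i < m then \<alpha> $$ (0, i) else 0)"
  define v1 where "v1 = id_left n1 p * mexp (y1 \<cdot>\<^sub>m aug_mat n1 \<theta>1 Q1) * minv (- aug_mat n1 \<theta>1 Q1)
    * aug_col n1 (exit_rates Q1)"
  define v2 where "v2 = id_left n2 p * mexp (y2 \<cdot>\<^sub>m aug_mat n2 \<theta>2 Q2) * minv (- aug_mat n2 \<theta>2 Q2)
    * aug_col n2 (exit_rates Q2)"
  define \<tau> where "\<tau> = shock_time m Z"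
  define R1 where "R1 = residual_lifetime p Y1"
  define R2 where "R2 = residual_lifetime p Y2"
  define S where "S k = {\<omega> \<in> space M. Z (\<tau> \<omega>) \<omega> = m + k}" for k
  have params: "common_shock_parameters m p \<alpha> T U Q1 Q2"
    using model by (simp add: common_shock_model_def)
  have \<alpha>: "\<alpha> \<in> carrier_mat 1 m" and T: "T \<in> carrier_mat m m" and U: "U \<in> carrier_mat m p"
    and Q1: "Q1 \<in> carrier_mat p p" and Q2: "Q2 \<in> carrier_mat p p"
    using params by (auto simp: common_shock_parameters_def subintensity_def)
  have Y1: "jump_process M (p + 1) Y1" and Y2: "jump_process M (p + 1) Y2"
    using model by (auto simp: common_shock_model_def)
  have Z: "absorbed_jump_process M m p \<pi> T U Z"
    using model T U unfolding absorbed_jump_process_def absorbed_jump_process_axioms_def common_shock_model_def \<pi>_def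
    by blast
  interpret Z: absorbed_jump_process M m p \<pi> T U Z by (rule Z)
  have \<tau>_eq: "exit_time {..<m} Z = \<tau>" by (simp add: \<tau>_def fun_eq_iff shock_time_def)
  have R_eq: "exit_time {..<p} Y1 = R1" "exit_time {..<p} Y2 = R2"
    by (simp_all add: R1_def R2_def fun_eq_iff residual_lifetime_def)
  have [measurable]: "\<tau> \<in> borel_measurable M"
    using Z.borel_measurable_\<tau> by (simp add: \<tau>_eq)
  have [measurable]: "R1 \<in> borel_measurable M" "R2 \<in> borel_measurable M"
    unfolding R_eq[symmetric]
    by (rule borel_measurable_exit_time[OF jump_process_right_continuous[OF Y1] jump_process_measurable[OF Y1]]
      borel_measurable_exit_time[OF jump_process_right_continuous[OF Y2] jump_process_measurable[OF Y2]]; assumption)+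
  have S_sets [measurable]: "S k \<in> sets M" for k
    using Z.exit_state_sets[of "m + k"] by (simp add: S_def \<tau>_eq)

  define C where "C k = Z.exit_moment n12 \<theta>12 k y12" for k
  have C: "(\<integral>\<^sup>+\<omega>. tail_weight n12 \<theta>12 y12 (\<tau> \<omega>) * indicator (S k) \<omega> \<partial>M) = ennreal (C k)" "0 \<le> C k" if "k < p" for k
  proof -
    note mom = Z.nn_integral_exit_moment[OF that y(1) conv(1) inv(1), unfolded \<tau>_eq]
    have "(\<integral>\<^sup>+\<omega>. tail_weight n12 \<theta>12 y12 (\<tau> \<omega>) * indicator (S k) \<omega> \<partial>M) =
      (\<integral>\<^sup>+\<omega>. ennreal (\<tau> \<omega> ^ n12 * exp (- \<theta>12 * \<tau> \<omega>)) *
        indicator {\<omega> \<in> space M. y12 < \<tau> \<omega> \<and> Z (\<tau> \<omega>) \<omega> = m + k} \<omega> \<partial>M)"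
      by (intro nn_integral_cong) (auto simp: tail_weight_def S_def split: split_indicator)
    then show "(\<integral>\<^sup>+\<omega>. tail_weight n12 \<theta>12 y12 (\<tau> \<omega>) * indicator (S k) \<omega> \<partial>M) = ennreal (C k)"
      using mom(1) by (simp add: C_def)
    show "0 \<le> C k" using mom(2) by (simp add: C_def)
  qed

  define h where "h \<omega> = tail_weight n12 \<theta>12 y12 (\<tau> \<omega>) * tail_weight n1 \<theta>1 y1 (R1 \<omega>) * tail_weight n2 \<theta>2 y2 (R2 \<omega>)" for \<omega>
  have h_borel [measurable]: "h \<in> borel_measurable M"
    unfolding h_def by measurable
  define D where "D k = C k * (fact n1 * v1 $$ (k, 0)) * (fact n2 * v2 $$ (k, 0))" for k

  have part: "(\<integral>\<^sup>+\<omega>. h \<omega> * indicator (S k) \<omega> \<partial>M) = ennreal (D k) \<and> 0 \<le> D k" if k: "k < p" for k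
  proof (cases "measure M (S k) = 0")
    case True
    \<comment> \<open>The model prescribes no conditional law for such \<open>k\<close>, but \<open>C k = 0\<close>, so both sides vanish.\<close>
    then have null: "AE \<omega> in M. \<omega> \<notin> S k"
      by (intro AE_not_in) (simp add: null_sets_def Z.emeasure_eq_measure)
    have zero: "(\<integral>\<^sup>+\<omega>. f \<omega> * indicator (S k) \<omega> \<partial>M) = 0" for f :: "'w \<Rightarrow> ennreal"
    proof -
      have "(\<integral>\<^sup>+\<omega>. f \<omega> * indicator (S k) \<omega> \<partial>M) = (\<integral>\<^sup>+\<omega>. 0 \<partial>M)"
        using null by (intro nn_integral_cong_AE) (auto elim!: eventually_mono)
      then show ?thesis by simp
    qed
    then have "C k = 0"
      using C[OF k] by (metis ennreal_eq_0_iff order_antisym)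
    then show ?thesis by (simp add: zero D_def)
  next
    case False
    then have pos: "0 < measure M (S k)"
      by (simp add: zero_less_measure_iff)
    define M' where "M' = given_shock_state M m Z k"
    have M'_eq: "M' = uniform_measure M (S k)"
      by (simp add: M'_def given_shock_state_def S_def \<tau>_def)
    have em: "emeasure M (S k) \<noteq> 0" "emeasure M (S k) \<noteq> \<infinity>"
      using pos by (auto simp: Z.emeasure_eq_measure)
    interpret M': prob_space M'
      unfolding M'_eq by (rule prob_space_uniform_measure[OF em])
    have sp: "space M' = space M" and se [measurable_cong]: "sets M' = sets M"
      by (simp_all add: M'_eq)
    let ?\<delta> = "\<lambda>i. if i = k then 1 else (0 :: real)"
    have cond: "markov_jump_process M' (p + 1) ?\<delta> (residual_intensity p Q1) Y1"
      "markov_jump_process M' (p + 1) ?\<delta> (residual_intensity p Q2) Y2"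
      "M'.indep_sets (\<lambda>i. [{\<tau> -` B \<inter> space M | B. B \<in> sets borel},
                 sigma_events M {0..} Y1, sigma_events M {0..} Y2] ! i) {..<3}"
      using model k pos unfolding common_shock_model_def Let_def M'_def S_def \<tau>_def by blast+
    note life1 = nn_integral_residual_lifetime[OF M'.prob_space_axioms Q1 k cond(1) y(2) conv(2) inv(2),
      folded v1_def R1_def]
    note life2 = nn_integral_residual_lifetime[OF M'.prob_space_axioms Q2 k cond(2) y(3) conv(3) inv(3),
      folded v2_def R2_def]
    have "(\<integral>\<^sup>+\<omega>. h \<omega> \<partial>M') = (\<integral>\<^sup>+\<omega>. tail_weight n12 \<theta>12 y12 (\<tau> \<omega>) \<partial>M') *
        (\<integral>\<^sup>+\<omega>. tail_weight n1 \<theta>1 y1 (R1 \<omega>) \<partial>M') * (\<integral>\<^sup>+\<omega>. tail_weight n2 \<theta>2 y2 (R2 \<omega>) \<partial>M')"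
      unfolding h_def
    proof (rule M'.nn_integral_indep3[OF cond(3)])
      show "(\<lambda>\<omega>. tail_weight n12 \<theta>12 y12 (\<tau> \<omega>)) \<in> borel_measurable M'"
        "(\<lambda>\<omega>. tail_weight n1 \<theta>1 y1 (R1 \<omega>)) \<in> borel_measurable M'"
        "(\<lambda>\<omega>. tail_weight n2 \<theta>2 y2 (R2 \<omega>)) \<in> borel_measurable M'"
        by measurable
      show "(\<lambda>\<omega>. tail_weight n12 \<theta>12 y12 (\<tau> \<omega>)) -` B \<inter> space M' \<in> {\<tau> -` B \<inter> space M | B. B \<in> sets borel}"
        if "B \<in> sets borel" for B
      proof -
        have "(\<lambda>\<omega>. tail_weight n12 \<theta>12 y12 (\<tau> \<omega>)) -` B \<inter> space M' = \<tau> -` (tail_weight n12 \<theta>12 y12 -` B) \<inter> space M"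
          by (auto simp: sp)
        moreover have "tail_weight n12 \<theta>12 y12 -` B \<in> sets borel"
          using measurable_sets[OF borel_measurable_tail_weight that] by simp
        ultimately show ?thesis by blast
      qed
    qed (auto simp: sp R_eq[symmetric] intro!: exit_time_event_in_sigma_events[OF Y1 borel_measurable_tail_weight]
        exit_time_event_in_sigma_events[OF Y2 borel_measurable_tail_weight])
    \<comment> \<open>Passing between the conditional measure and \<open>M\<close>; applied to \<open>h\<close> and to the factor of \<open>\<tau>\<close>.\<close>
    moreover have unif: "(\<integral>\<^sup>+\<omega>. f \<omega> * indicator (S k) \<omega> \<partial>M) = emeasure M (S k) * (\<integral>\<^sup>+\<omega>. f \<omega> \<partial>M')"
      if "f \<in> borel_measurable M" for f
      unfolding M'_eq nn_integral_uniform_measure[OF that S_sets]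
      using em by (metis ennreal_mult_divide_eq ennreal_times_divide mult.commute infinity_ennreal_def)
    ultimately have "(\<integral>\<^sup>+\<omega>. h \<omega> * indicator (S k) \<omega> \<partial>M) =
        (\<integral>\<^sup>+\<omega>. tail_weight n12 \<theta>12 y12 (\<tau> \<omega>) * indicator (S k) \<omega> \<partial>M) *
        (\<integral>\<^sup>+\<omega>. tail_weight n1 \<theta>1 y1 (R1 \<omega>) \<partial>M') * (\<integral>\<^sup>+\<omega>. tail_weight n2 \<theta>2 y2 (R2 \<omega>) \<partial>M')"
      by (simp add: mult.assoc)
    also have "\<dots> = ennreal (C k) * ennreal (fact n1 * v1 $$ (k, 0)) * ennreal (fact n2 * v2 $$ (k, 0))"
      using C(1)[OF k] life1 life2 by simp
    also have "\<dots> = ennreal (D k)"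
      unfolding D_def using C(2)[OF k] life1 life2 by (simp only: ennreal_mult mult_nonneg_nonneg)
    finally show ?thesis
      unfolding D_def using C(2)[OF k] life1 life2 by (auto intro!: mult_nonneg_nonneg)
  qed

  \<comment> \<open>Where \<open>\<tau> > y12 \<ge> 0\<close>, the path does leave the pre-shock states, so exactly one of the events \<open>S k\<close>
    occurs; elsewhere the integrand is \<open>0\<close>.\<close>
  have decompose: "h \<omega> = (\<Sum>k<p. h \<omega> * indicator (S k) \<omega>)" if \<omega>: "\<omega> \<in> space M" for \<omega>
  proof (cases "y12 < \<tau> \<omega>")
    case True
    have "Z (\<tau> \<omega>) \<omega> \<notin> {..<m}"
      using jump_process_right_continuous[OF Z.process \<omega>] True y(1)
      unfolding \<tau>_eq[symmetric] by (intro exit_time_pos_left[of Z \<omega>]) auto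
    moreover have "Z (\<tau> \<omega>) \<omega> < m + p"
      using jump_process_less[OF Z.process _ \<omega>, of "\<tau> \<omega>"] exit_time_nonneg[of "{..<m}" Z \<omega>] by (simp add: \<tau>_eq)
    ultimately obtain k0 where k0: "k0 < p" "Z (\<tau> \<omega>) \<omega> = m + k0"
      by (metis add_less_cancel_left le_Suc_ex lessThan_iff not_less)
    have "(\<Sum>k<p. h \<omega> * indicator (S k) \<omega>) = (\<Sum>k<p. if k = k0 then h \<omega> else 0)"
      using k0 \<omega> by (intro sum.cong refl) (auto simp: S_def)
    then show ?thesis using k0 by simp
  next
    case False
    then show ?thesis by (simp add: h_def tail_weight_def)
  qed
  have "(\<integral>\<^sup>+\<omega>. h \<omega> \<partial>M) = (\<integral>\<^sup>+\<omega>. (\<Sum>k<p. h \<omega> * indicator (S k) \<omega>) \<partial>M)"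
    by (intro nn_integral_cong decompose)
  also have "\<dots> = (\<Sum>k<p. \<integral>\<^sup>+\<omega>. h \<omega> * indicator (S k) \<omega> \<partial>M)"
    by (intro nn_integral_sum) measurable
  also have "\<dots> = (\<Sum>k<p. ennreal (D k))"
    using part by simp
  also have "\<dots> = ennreal (\<Sum>k<p. D k)"
    using part by (intro sum_ennreal) auto
  finally have total: "(\<integral>\<^sup>+\<omega>. h \<omega> \<partial>M) = ennreal (\<Sum>k<p. D k)" .

  have formula: "(fact n12 * fact n1 * fact n2) *
      (aug_row n12 \<alpha> * mexp (y12 \<cdot>\<^sub>m aug_mat n12 \<theta>12 T) * minv (- aug_mat n12 \<theta>12 T)
        * id_down n12 m * shock_matrix U * kron v1 v2) $$ (0, 0) = (\<Sum>k<p. D k)"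
  proof -
    have A: "aug_mat n12 \<theta>12 T \<in> carrier_mat ((n12 + 1) * m) ((n12 + 1) * m)"
      by (rule aug_mat_carrier[OF T])
    have v: "v1 \<in> carrier_mat p 1" "v2 \<in> carrier_mat p 1"
      using Q1 Q2 by (auto simp: v1_def v2_def id_left_def aug_col_def Let_def)
    show ?thesis
      unfolding master_product_entry[OF \<alpha> mexp_carrier[OF smult_carrier_mat[OF A]] minv_uminus(1)[OF A inv(1)] U v]
      unfolding D_def C_def Z.exit_moment_def by (simp add: \<pi>_def sum_distrib_left sum_distrib_right mult_ac)
  qed

  let ?f = "\<lambda>\<omega>. (\<tau> \<omega> ^ n12 * exp (- \<theta>12 * \<tau> \<omega>)) * (R1 \<omega> ^ n1 * exp (- \<theta>1 * R1 \<omega>))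
        * (R2 \<omega> ^ n2 * exp (- \<theta>2 * R2 \<omega>))
        * indicator {\<omega> \<in> space M. y12 < \<tau> \<omega> \<and> y1 < R1 \<omega> \<and> y2 < R2 \<omega>} \<omega>"
  have nonneg: "0 \<le> \<tau> \<omega>" "0 \<le> R1 \<omega>" "0 \<le> R2 \<omega>" for \<omega>
    unfolding \<tau>_eq[symmetric] R_eq[symmetric] by (rule exit_time_nonneg)+
  have "has_bochner_integral M ?f (\<Sum>k<p. D k)"
  proof (rule has_bochner_integral_nn_integral)
    show "?f \<in> borel_measurable M" by measurable
    show "AE \<omega> in M. 0 \<le> ?f \<omega>" using nonneg by (intro AE_I2) simp
    show "0 \<le> (\<Sum>k<p. D k)" using part by (intro sum_nonneg) auto
    have "(\<integral>\<^sup>+\<omega>. ennreal (?f \<omega>) \<partial>M) = (\<integral>\<^sup>+\<omega>. h \<omega> \<partial>M)"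
      using nonneg by (intro nn_integral_cong)
        (auto simp: h_def tail_weight_def ennreal_mult[symmetric] split: split_indicator)
    then show "(\<integral>\<^sup>+\<omega>. ennreal (?f \<omega>) \<partial>M) = ennreal (\<Sum>k<p. D k)"
      unfolding total .
  qed
  then show ?thesis
    unfolding formula[symmetric] v1_def[symmetric] v2_def[symmetric] \<tau>_def R1_def R2_def .
qed

end
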